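(* Let $f\in L^2(\mathbb{R}^N)$ with $\mathcal{Q}_{\boldsymbol{\Lambda}}f\in L^1(\mathbb{R}^N)$. Then for almost every $\boldsymbol{x}\in\mathbb{R}^N$, $$f(\boldsymbol{x})=\int_{\mathbb{R}^N}(\mathcal{Q}_{\boldsymbol{\Lambda}}f)(\boldsymbol{t})\,\mathcal{K}_{-\boldsymbol{\Lambda}}(\boldsymbol{t},\boldsymbol{x})\,d\boldsymbol{t}.$$
   Context: Let $N\ge 1$ and $\boldsymbol{\Lambda}=(\Lambda_1,\dots,\Lambda_N)$ with $\Lambda_k=(a_k,b_k,c_k,d_k,e_k)\in\mathbb{R}^5$ and $b_k\neq 0$ for $k=1,\dots,N$. With principal square roots, for $\boldsymbol{\omega},\boldsymbol{x}\in\mathbb{R}^N$ put $$\mathcal{K}_{\boldsymbol{\Lambda}}(\boldsymbol{\omega},\boldsymbol{x})=\prod_{k=1}^N\sqrt{\tfrac{b_k}{2\pi i}}\;e^{i(a_kx_k^2+b_kx_k\omega_k+c_k\omega_k^2+d_kx_k+e_k\omega_k)},$$ $$\mathcal{K}_{-\boldsymbol{\Lambda}}(\boldsymbol{\omega},\boldsymbol{x})=\prod_{k=1}^N\sqrt{\tfrac{b_k i}{2\pi}}\;e^{-i(a_kx_k^2+b_kx_k\omega_k+c_k\omega_k^2+d_kx_k+e_k\omega_k)}.$$ The multidimensional QPFT on $L^1(\mathbb{R}^N)$ is $(\mathcal{Q}_{\boldsymbol{\Lambda}}f)(\boldsymbol{\omega})=\int_{\mathbb{R}^N}\mathcal{K}_{\boldsymbol{\Lambda}}(\boldsymbol{\omega},\boldsymbol{x})f(\boldsymbol{x})\,d\boldsymbol{x}$;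 on $L^2(\mathbb{R}^N)$, $\mathcal{Q}_{\boldsymbol{\Lambda}}$ denotes the continuous extension to $L^2(\mathbb{R}^N)$ of its restriction to $L^1(\mathbb{R}^N)\cap L^2(\mathbb{R}^N)$. *)

theory Defs
  imports "HOL-Analysis.Analysis"
begin

text \<open>
  Parameters \<open>\<Lambda>\<^sub>k = (a\<^sub>k, b\<^sub>k, c\<^sub>k, d\<^sub>k, e\<^sub>k)\<close> of one coordinate.  The dimension \<open>N \<ge> 1\<close> is
  the cardinality of the index type \<open>'n\<close>.
\<close>
type_synonym qpft_param = "real \<times> real \<times> real \<times> real \<times> real"

definition qpft_kernel ::
  "qpft_param ^ 'n \<Rightarrow> real ^ 'n \<Rightarrow> real ^ 'n \<Rightarrow> complex" where
  "qpft_kernel \<Lambda> \<omega> x =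
     (\<Prod>k\<in>UNIV. case \<Lambda> $ k of (a, b, c, d, e) \<Rightarrow>
        csqrt (of_real b / (2 * of_real pi * \<i>)) *
        exp (\<i> * of_real (a * (x $ k)^2 + b * (x $ k) * (\<omega> $ k) + c * (\<omega> $ k)^2
                          + d * (x $ k) + e * (\<omega> $ k))))"

definition qpft_kernel_neg ::
  "qpft_param ^ 'n \<Rightarrow> real ^ 'n \<Rightarrow> real ^ 'n \<Rightarrow> complex" where
  "qpft_kernel_neg \<Lambda> \<omega> x =
     (\<Prod>k\<in>UNIV. case \<Lambda> $ k of (a, b, c, d, e) \<Rightarrow>
        csqrt (of_real b * \<i> / (2 * of_real pi)) *
        exp (- \<i> * of_real (a * (x $ k)^2 + b * (x $ k) * (\<omega> $ k) + c * (\<omega> $ k)^2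
                            + d * (x $ k) + e * (\<omega> $ k))))"

text \<open>
  Elements of \<open>L\<^sup>1\<close> and \<open>L\<^sup>2\<close> are represented by functions, not by classes modulo null sets;
  accordingly \<open>L2_norm\<close> is only a seminorm and identities are stated almost everywhere.
\<close>
definition L1 :: "(real ^ 'n \<Rightarrow> complex) set" where
  "L1 = {f. integrable lebesgue f}"

definition L2 :: "(real ^ 'n \<Rightarrow> complex) set" where
  "L2 = {f \<in> borel_measurable lebesgue. integrable lebesgue (\<lambda>x. (norm (f x))^2)}"

definition L2_norm :: "(real ^ 'n \<Rightarrow> complex) \<Rightarrow> real" where
  "L2_norm f = sqrt (\<integral>x. (norm (f x))^2 \<partial>lebesgue)"

definition qpft_L1 ::
  "qpft_param ^ 'n \<Rightarrow> (real ^ 'n \<Rightarrow> complex) \<Rightarrow> real ^ 'n \<Rightarrow> complex" where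
  "qpft_L1 \<Lambda> f \<omega> = (\<integral>x. qpft_kernel \<Lambda> \<omega> x * f x \<partial>lebesgue)"

text \<open>
  \<open>T\<close> is a continuous map from \<open>L\<^sup>2\<close> to \<open>L\<^sup>2\<close> extending the transform on \<open>L\<^sup>1 \<inter> L\<^sup>2\<close>.
  Continuity for the seminorm already makes \<open>T\<close> respect equality almost everywhere.
\<close>
definition qpft_L2_extension ::
  "qpft_param ^ 'n \<Rightarrow> ((real ^ 'n \<Rightarrow> complex) \<Rightarrow> (real ^ 'n \<Rightarrow> complex)) \<Rightarrow> bool" where
  "qpft_L2_extension \<Lambda> T \<longleftrightarrow>
     (\<forall>f\<in>L2. T f \<in> L2) \<and>
     (\<forall>f\<in>L2. \<forall>\<epsilon>>0. \<exists>\<delta>>0. \<forall>g\<in>L2.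
        L2_norm (\<lambda>x. g x - f x) < \<delta> \<longrightarrow> L2_norm (\<lambda>\<omega>. T g \<omega> - T f \<omega>) < \<epsilon>) \<and>
     (\<forall>f\<in>L1 \<inter> L2. AE \<omega> in lebesgue. T f \<omega> = qpft_L1 \<Lambda> f \<omega>)"

text \<open>
  The extension is unique up to null sets, by density of \<open>L\<^sup>1 \<inter> L\<^sup>2\<close> in \<open>L\<^sup>2\<close>; the choice
  operator only selects representatives.
\<close>
definition qpft_L2 ::
  "qpft_param ^ 'n \<Rightarrow> (real ^ 'n \<Rightarrow> complex) \<Rightarrow> real ^ 'n \<Rightarrow> complex" where
  "qpft_L2 \<Lambda> = (SOME T. qpft_L2_extension \<Lambda> T)"

end

theory Submission
  imports Defs "HOL-Probability.Characteristic_Functions"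
begin

text \<open>
The kernel satisfies \<open>K\<^sub>-\<^sub>\<Lambda> = cnj K\<^sub>\<Lambda>\<close>, and \<open>K\<^sub>\<Lambda>(\<omega>,x) cnj K\<^sub>\<Lambda>(\<omega>,y)\<close> is, coordinate by coordinate, the
Fourier exponential \<open>\<bar>b\<bar>/(2\<pi>) exp(i b (x - y) \<omega>)\<close> times a unimodular factor \<open>p(x) cnj (p(y))\<close>
that does not involve \<open>\<omega>\<close>: the chirp \<open>p(x) = exp(i (a x\<^sup>2 + d x))\<close>.  Hence inserting the Gaussian
weight \<open>w\<^sub>s(\<omega>) = exp(- (s b \<omega>)\<^sup>2 / 2)\<close> makes the \<open>\<omega>\<close>-integral explicit: it is
\<open>p(x) cnj (p(y)) g\<^sub>s(x - y)\<close> with \<open>g\<^sub>s\<close> the centred normal density of standard deviation \<open>s\<close>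
(\<open>damped_kernel_integral\<close>).  By Fubini every integrable \<open>f\<close> satisfies the damped inversion formula

  \<open>\<integral> w\<^sub>s(\<omega>) (Q f)(\<omega>) cnj K(\<omega>,y) d\<omega> = cnj (p(y)) \<integral> f(x) p(x) g\<^sub>s(x - y) dx\<close>,

and everything else is extracted from this one identity.

Since \<open>qpft_L2\<close> is a choice, it is first shown that a continuous extension exists.  Pairing the damped
formula with \<open>cnj f\<close> and using \<open>\<bar>f(x) f(y)\<bar> \<le> (\<bar>f(x)\<bar>\<^sup>2 + \<bar>f(y)\<bar>\<^sup>2) / 2\<close> and \<open>\<integral> g\<^sub>s = 1\<close> bounds the damped
energy of \<open>Q f\<close> by that of \<open>f\<close>; with \<open>s \<rightarrow> 0\<close> and Fatou's lemma, \<open>Q\<close> is a contraction for the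
\<open>L\<^sup>2\<close>-norm (\<open>Plancherel_bound\<close>).  By the completeness of \<open>L\<^sup>2\<close>
(\<open>Riesz_Fischer\<close>), the extension can be taken to be the \<open>L\<^sup>2\<close>-limit of the transforms of the truncations of \<open>f\<close> to
balls.

For fixed \<open>y\<close> and \<open>s\<close> both sides of the damped formula are integrals against square-integrable
functions, so the formula passes to \<open>f\<close> in \<open>L\<^sup>2\<close>, with the chosen extension in place of \<open>Q\<close>
(\<open>damped_inversion_L2\<close>).  If the transform of \<open>f\<close> is integrable, the left-hand side converges as
\<open>s \<rightarrow> 0\<close>, for every \<open>y\<close> and boundedly, to the inversion integral.  The right-hand side is, up to
the factor \<open>cnj (p(y))\<close>, a Gaussian smoothing of \<open>F = f p\<close>.  A bounded pointwise limit of such smoothings has the same integral over every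
box as \<open>F\<close>, so it equals \<open>F\<close> almost everywhere by Lebesgue differentiation
(\<open>pointwise_limit_of_gauss_smoothing\<close>).  Dividing by the chirp gives the claim.
\<close>

section \<open>Square-integrable functions and completeness\<close>

definition square_integrable :: "'a measure \<Rightarrow> ('a \<Rightarrow> complex) \<Rightarrow> bool" where
  "square_integrable M f \<longleftrightarrow> f \<in> borel_measurable M \<and> integrable M (\<lambda>x. (norm (f x))\<^sup>2)"

lemma square_integrableD:
  assumes "square_integrable M f"
  shows "f \<in> borel_measurable M" "integrable M (\<lambda>x. (norm (f x))\<^sup>2)"
  using assms by (auto simp: square_integrable_def)

text \<open>
A crude substitute for the triangle inequality: squared norms stay polynomial and no square roots of
integrals appear.
\<close>
lemma norm_add_power2_le:
  fixes a b :: complex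
  shows "(norm (a + b))\<^sup>2 \<le> 2 * (norm a)\<^sup>2 + 2 * (norm b)\<^sup>2"
proof -
  have "(norm (a + b))\<^sup>2 \<le> (norm a + norm b)\<^sup>2"
    by (intro power_mono norm_triangle_ineq) auto
  also have "\<dots> \<le> 2 * (norm a)\<^sup>2 + 2 * (norm b)\<^sup>2"
    using sum_squares_bound[of "norm a" "norm b"] by (simp add: power2_sum)
  finally show ?thesis .
qed

lemma mult_le_sum_squares:
  fixes a b :: real
  assumes "a \<ge> 0" "b \<ge> 0"
  shows "a * b \<le> a\<^sup>2 + b\<^sup>2"
  using sum_squares_bound[of a b] mult_nonneg_nonneg[OF assms] by linarith

lemma norm_le_power2_plus_1: "norm a \<le> (norm a)\<^sup>2 + 1"
  using mult_le_sum_squares[of "norm a" 1] by simp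

lemma square_integrable_bounded:
  assumes "f \<in> borel_measurable M" "integrable M g" "\<And>x. (norm (f x))\<^sup>2 \<le> g x"
  shows "square_integrable M f"
  unfolding square_integrable_def
proof (intro conjI assms(1) Bochner_Integration.integrable_bound[OF assms(2)] AE_I2)
  fix x show "norm ((norm (f x))\<^sup>2) \<le> norm (g x)"
    using assms(3)[of x] by (simp add: order_trans[OF _ abs_ge_self])
qed (use assms(1) in measurable)

lemma square_integrable_add:
  assumes f: "square_integrable M f" and g: "square_integrable M g"
  shows "square_integrable M (\<lambda>x. f x + g x)"
    and "(\<integral>x. (norm (f x + g x))\<^sup>2 \<partial>M) \<le> 2 * (\<integral>x. (norm (f x))\<^sup>2 \<partial>M) + 2 * (\<integral>x. (norm (g x))\<^sup>2 \<partial>M)"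
proof -
  note [measurable] = square_integrableD(1)[OF f] square_integrableD(1)[OF g]
  have i: "integrable M (\<lambda>x. 2 * (norm (f x))\<^sup>2 + 2 * (norm (g x))\<^sup>2)"
    using square_integrableD(2)[OF f] square_integrableD(2)[OF g] by auto
  show 1: "square_integrable M (\<lambda>x. f x + g x)"
    by (rule square_integrable_bounded[OF _ i norm_add_power2_le]) measurable
  have "(\<integral>x. (norm (f x + g x))\<^sup>2 \<partial>M) \<le> (\<integral>x. 2 * (norm (f x))\<^sup>2 + 2 * (norm (g x))\<^sup>2 \<partial>M)"
    by (intro integral_mono square_integrableD(2)[OF 1] i norm_add_power2_le)
  then show "(\<integral>x. (norm (f x + g x))\<^sup>2 \<partial>M) \<le> 2 * (\<integral>x. (norm (f x))\<^sup>2 \<partial>M) + 2 * (\<integral>x. (norm (g x))\<^sup>2 \<partial>M)"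
    using square_integrableD(2)[OF f] square_integrableD(2)[OF g] by simp
qed

lemma square_integrable_uminus:
  "square_integrable M f \<Longrightarrow> square_integrable M (\<lambda>x. - f x)"
  by (simp add: square_integrable_def)

lemma square_integrable_diff:
  assumes f: "square_integrable M f" and g: "square_integrable M g"
  shows "square_integrable M (\<lambda>x. f x - g x)"
    and "(\<integral>x. (norm (f x - g x))\<^sup>2 \<partial>M) \<le> 2 * (\<integral>x. (norm (f x))\<^sup>2 \<partial>M) + 2 * (\<integral>x. (norm (g x))\<^sup>2 \<partial>M)"
  using square_integrable_add[OF f square_integrable_uminus[OF g]] by simp_all

lemma square_integrable_mult:
  assumes f: "square_integrable M f" and g: "square_integrable M g"
  shows "integrable M (\<lambda>x. f x * g x)"
proof -
  note [measurable] = square_integrableD(1)[OF f] square_integrableD(1)[OF g]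
  have i: "integrable M (\<lambda>x. (norm (f x))\<^sup>2 + (norm (g x))\<^sup>2)"
    using square_integrableD(2)[OF f] square_integrableD(2)[OF g] by auto
  show ?thesis
    by (rule Bochner_Integration.integrable_bound[OF i])
       (auto simp: norm_mult intro!: AE_I2 mult_le_sum_squares)
qed

lemma integral_mult_square_le:
  assumes f: "square_integrable M f" and g: "square_integrable M g"
  shows "(norm (\<integral>x. f x * g x \<partial>M))\<^sup>2 \<le> (\<integral>x. (norm (f x))\<^sup>2 \<partial>M) * (\<integral>x. (norm (g x))\<^sup>2 \<partial>M)"
proof -
  note [measurable] = square_integrableD(1)[OF f] square_integrableD(1)[OF g]
  have i: "integrable M (\<lambda>x. norm (f x) * norm (g x))"
    using integrable_norm[OF square_integrable_mult[OF f g]] by (simp add: norm_mult)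
  have "ennreal ((\<integral>x. norm (f x) * norm (g x) \<partial>M)\<^sup>2) = (\<integral>\<^sup>+x. ennreal (norm (f x)) * ennreal (norm (g x)) \<partial>M)\<^sup>2"
    using nn_integral_eq_integral[OF i] by (simp add: ennreal_power ennreal_mult)
  also have "\<dots> \<le> (\<integral>\<^sup>+x. ennreal (norm (f x)) ^ 2 \<partial>M) * (\<integral>\<^sup>+x. ennreal (norm (g x)) ^ 2 \<partial>M)"
    by (rule Cauchy_Schwarz_nn_integral) measurable
  also have "\<dots> = ennreal ((\<integral>x. (norm (f x))\<^sup>2 \<partial>M) * (\<integral>x. (norm (g x))\<^sup>2 \<partial>M))"
    using nn_integral_eq_integral[OF square_integrableD(2)[OF f]]
      nn_integral_eq_integral[OF square_integrableD(2)[OF g]]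
    by (simp add: ennreal_power ennreal_mult)
  finally have "(\<integral>x. norm (f x) * norm (g x) \<partial>M)\<^sup>2
      \<le> (\<integral>x. (norm (f x))\<^sup>2 \<partial>M) * (\<integral>x. (norm (g x))\<^sup>2 \<partial>M)"
    by (simp add: ennreal_le_iff)
  moreover have "norm (\<integral>x. f x * g x \<partial>M) \<le> (\<integral>x. norm (f x) * norm (g x) \<partial>M)"
    using integral_norm_bound[of M "\<lambda>x. f x * g x"] by (simp add: norm_mult)
  ultimately show ?thesis
    by (meson norm_ge_zero order_trans power_mono)
qed

text \<open>
By Cauchy-Schwarz, integration against a square-integrable function is continuous for convergence in
mean square.  This is what carries identities from integrable functions to square-integrable ones.
\<close>
lemma tendsto_integral_mult:
  assumes f: "\<And>n. square_integrable M (f n)" and h: "square_integrable M h" and g: "square_integrable M g"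
    and lim: "(\<lambda>n. \<integral>x. (norm (f n x - h x))\<^sup>2 \<partial>M) \<longlonglongrightarrow> 0"
  shows "(\<lambda>n. \<integral>x. f n x * g x \<partial>M) \<longlonglongrightarrow> (\<integral>x. h x * g x \<partial>M)"
proof -
  have eq: "(\<integral>x. f n x * g x \<partial>M) - (\<integral>x. h x * g x \<partial>M) = (\<integral>x. (f n x - h x) * g x \<partial>M)" for n
    by (simp add: left_diff_distrib square_integrable_mult f h g)
  have "(\<lambda>n. (norm (\<integral>x. (f n x - h x) * g x \<partial>M))\<^sup>2) \<longlonglongrightarrow> 0"
  proof (rule tendsto_sandwich[OF _ _ tendsto_const])
    show "(\<lambda>n. (\<integral>x. (norm (f n x - h x))\<^sup>2 \<partial>M) * (\<integral>x. (norm (g x))\<^sup>2 \<partial>M)) \<longlonglongrightarrow> 0"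
      using tendsto_mult_right[OF lim] by simp
  qed (auto intro!: always_eventually integral_mult_square_le square_integrable_diff f g h)
  then have "(\<lambda>n. norm (\<integral>x. (f n x - h x) * g x \<partial>M)) \<longlonglongrightarrow> 0"
    using tendsto_real_sqrt[of _ 0] by fastforce
  then have "(\<lambda>n. (\<integral>x. f n x * g x \<partial>M) - (\<integral>x. h x * g x \<partial>M)) \<longlonglongrightarrow> 0"
    unfolding eq by (rule tendsto_norm_zero_cancel)
  then show ?thesis
    by (rule LIM_zero_cancel)
qed

text \<open>
Along a subsequence with \<open>\<parallel>u (r (k + 1)) - u (r k)\<parallel>\<^sup>2 \<le> 4\<^sup>-\<^sup>k\<close> the increments \<open>d\<^sub>k\<close> satisfy \<open>\<Sum>\<^sub>k 2\<^sup>k \<integral> \<bar>d\<^sub>k\<bar>\<^sup>2 < \<infinity>\<close>, so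
\<open>\<Sum>\<^sub>k 2\<^sup>k \<bar>d\<^sub>k\<bar>\<^sup>2\<close> is finite almost everywhere; as \<open>\<bar>d\<^sub>k\<bar> \<le> 2\<^sup>k \<bar>d\<^sub>k\<bar>\<^sup>2 + 2\<^sup>-\<^sup>k\<close>, the subsequence converges
almost everywhere.  Fatou's lemma turns the pointwise limit into a limit in mean square.
\<close>
lemma Riesz_Fischer:
  assumes u: "\<And>n. square_integrable M (u n)"
    and Cauchy: "\<And>e. e > 0 \<Longrightarrow> \<exists>N. \<forall>m\<ge>N. \<forall>n\<ge>N. (\<integral>x. (norm (u m x - u n x))\<^sup>2 \<partial>M) < e"
  shows "\<exists>v. square_integrable M v \<and> (\<lambda>n. \<integral>x. (norm (u n x - v x))\<^sup>2 \<partial>M) \<longlonglongrightarrow> 0"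
proof -
  note [measurable] = square_integrableD(1)[OF u]
  have ud: "integrable M (\<lambda>x. (norm (u m x - u n x))\<^sup>2)" for m n
    using square_integrableD(2)[OF square_integrable_diff(1)[OF u u]] .
  have "\<exists>N. \<forall>m\<ge>N. \<forall>n\<ge>N. (\<integral>x. (norm (u m x - u n x))\<^sup>2 \<partial>M) < (1/4)^k" for k
    by (rule Cauchy) simp
  then obtain N where N: "\<And>k m n. m \<ge> N k \<Longrightarrow> n \<ge> N k \<Longrightarrow> (\<integral>x. (norm (u m x - u n x))\<^sup>2 \<partial>M) < (1/4)^k"
    by metis
  \<comment> \<open>A monotone choice of indices that dominates \<open>N\<close>.\<close>
  define r where "r k = (\<Sum>i\<le>k. N i) + k" for k
  have r_ge: "N k \<le> r k" for k
    unfolding r_def by (simp add: trans_le_add1 member_le_sum)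
  have r_Suc: "r k \<le> r (Suc k)" for k
    by (simp add: r_def)
  have r_mono: "r j \<le> r k" if "j \<le> k" for j k
    using lift_Suc_mono_le[of r, OF r_Suc that] .
  define d where "d k x = u (r (Suc k)) x - u (r k) x" for k x
  have d[measurable]: "d k \<in> borel_measurable M" for k
    unfolding d_def by measurable
  have nn_d: "(\<integral>\<^sup>+x. ennreal (2^k * (norm (d k x))\<^sup>2) \<partial>M) \<le> ennreal ((1/2)^k)" for k
  proof -
    have i: "integrable M (\<lambda>x. 2^k * (norm (d k x))\<^sup>2)"
      unfolding d_def using ud by auto
    have "(\<integral>x. (norm (d k x))\<^sup>2 \<partial>M) \<le> (1/4)^k"
      unfolding d_def using N[of k "r (Suc k)" "r k"] r_ge[of k] r_Suc[of k] by simp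
    then have "2^k * (\<integral>x. (norm (d k x))\<^sup>2 \<partial>M) \<le> 2^k * (1/4)^k"
      by (intro mult_left_mono) auto
    also have "(2::real)^k * (1/4)^k = (1/2)^k"
      unfolding power_mult_distrib[symmetric] by simp
    finally show ?thesis
      using nn_integral_eq_integral[OF i] by (simp add: ennreal_leI)
  qed
  have sum_half: "(\<Sum>k. ennreal ((1/2)^k)) < \<infinity>"
    by (subst suminf_ennreal2) (auto simp: summable_geometric)
  have "(\<integral>\<^sup>+x. (\<Sum>k. ennreal (2^k * (norm (d k x))\<^sup>2)) \<partial>M) = (\<Sum>k. \<integral>\<^sup>+x. ennreal (2^k * (norm (d k x))\<^sup>2) \<partial>M)"
    by (rule nn_integral_suminf) measurable
  also have "\<dots> \<le> (\<Sum>k. ennreal ((1/2)^k))"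
    by (intro suminf_le nn_d) auto
  also note sum_half
  finally have "AE x in M. (\<Sum>k. ennreal (2^k * (norm (d k x))\<^sup>2)) \<noteq> \<infinity>"
    by (intro nn_integral_noteq_infinite) auto
  then have AE_conv: "AE x in M. convergent (\<lambda>k. u (r k) x)"
  proof eventually_elim
    case (elim x)
    then have 1: "summable (\<lambda>k. 2^k * (norm (d k x))\<^sup>2)"
      by (intro summable_suminf_not_top) auto
    have "summable (\<lambda>k. (2^k * (norm (d k x))\<^sup>2 + (1/2)^k))"
      by (intro summable_add 1 summable_geometric) auto
    then have "summable (\<lambda>k. d k x)"
    proof (rule summable_comparison_test'[where N = 0])
      fix k :: nat
      \<comment> \<open>The weights \<open>2\<^sup>k\<close> and \<open>2\<^sup>-\<^sup>k\<close> are split evenly, so that \<open>a b \<le> a\<^sup>2 + b\<^sup>2\<close> yields two summable terms.\<close>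
      have "norm (d k x) * 1 = (sqrt (2^k) * norm (d k x)) * sqrt ((1/2)^k)"
        by (simp add: real_sqrt_mult[symmetric] power_mult_distrib[symmetric] mult.commute mult.left_commute
             del: mult_1_right)
      also have "\<dots> \<le> (sqrt (2^k) * norm (d k x))\<^sup>2 + (sqrt ((1/2)^k))\<^sup>2"
        by (intro mult_le_sum_squares) auto
      also have "\<dots> = 2^k * (norm (d k x))\<^sup>2 + (1/2)^k"
        by (simp add: power_mult_distrib)
      finally show "norm (d k x) \<le> 2^k * (norm (d k x))\<^sup>2 + (1/2)^k" by simp
    qed
    then have "convergent (\<lambda>n. \<Sum>k<n. d k x)"
      using summable_iff_convergent by blast
    moreover have "(\<Sum>k<n. d k x) = u (r n) x - u (r 0) x" for n
      unfolding d_def by (rule sum_lessThan_telescope)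
    ultimately have "convergent (\<lambda>n. u (r n) x - u (r 0) x)" by simp
    then show ?case
      using convergent_diff_const_right_iff by blast
  qed
  define v where "v x = lim (\<lambda>k. u (r k) x)" for x
  have v[measurable]: "v \<in> borel_measurable M"
    unfolding v_def by measurable
  have Fatou: "(\<integral>\<^sup>+x. ennreal ((norm (u n x - v x))\<^sup>2) \<partial>M) \<le> ennreal ((1/4)^j)" if n: "n \<ge> r j" for n j
  proof -
    have "(\<integral>\<^sup>+x. ennreal ((norm (u n x - v x))\<^sup>2) \<partial>M)
      = (\<integral>\<^sup>+x. liminf (\<lambda>k. ennreal ((norm (u n x - u (r k) x))\<^sup>2)) \<partial>M)"
      using AE_conv
    proof (intro nn_integral_cong_AE, eventually_elim)
      case (elim x)
      then have "(\<lambda>k. u (r k) x) \<longlonglongrightarrow> v x"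
        by (simp add: v_def convergent_LIMSEQ_iff)
      then have "(\<lambda>k. ennreal ((norm (u n x - u (r k) x))\<^sup>2)) \<longlonglongrightarrow> ennreal ((norm (u n x - v x))\<^sup>2)"
        by (intro tendsto_intros)
      then show ?case
        by (intro lim_imp_Liminf[symmetric]) simp_all
    qed
    also have "\<dots> \<le> liminf (\<lambda>k. \<integral>\<^sup>+x. ennreal ((norm (u n x - u (r k) x))\<^sup>2) \<partial>M)"
      by (rule nn_integral_liminf) measurable
    also have "\<dots> \<le> liminf (\<lambda>k::nat. ennreal ((1/4)^j))"
    proof (rule Liminf_mono)
      show "\<forall>\<^sub>F k in sequentially. (\<integral>\<^sup>+x. ennreal ((norm (u n x - u (r k) x))\<^sup>2) \<partial>M) \<le> ennreal ((1/4)^j)"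
        using eventually_ge_at_top[of j]
      proof eventually_elim
        case (elim k)
        have "(\<integral>x. (norm (u n x - u (r k) x))\<^sup>2 \<partial>M) \<le> (1/4)^j"
          using N[of j n "r k"] r_ge[of j] r_mono[OF elim] n by simp
        then show ?case
          using nn_integral_eq_integral[OF ud] by (simp add: ennreal_leI)
      qed
    qed
    also have "\<dots> = ennreal ((1/4)^j)" by (simp add: Liminf_const)
    finally show ?thesis .
  qed
  have sd: "square_integrable M (\<lambda>x. u n x - v x)" if n: "n \<ge> r j" for n j
    unfolding square_integrable_def
    using Fatou[OF n] by (auto intro!: integrableI_nonneg intro: le_less_trans)
  have sv: "square_integrable M v"
    using square_integrable_diff(1)[OF u[of "r 0"] sd[of 0 "r 0", OF order_refl]] by simp
  have bound: "(\<integral>x. (norm (u n x - v x))\<^sup>2 \<partial>M) \<le> (1/4)^j" if n: "n \<ge> r j" for n j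
    using Fatou[OF n] nn_integral_eq_integral[OF square_integrableD(2)[OF sd[OF n]]]
    by (simp add: ennreal_le_iff)
  have "(\<lambda>n. \<integral>x. (norm (u n x - v x))\<^sup>2 \<partial>M) \<longlonglongrightarrow> 0"
  proof (rule LIMSEQ_I)
    fix e :: real assume "e > 0"
    then obtain j where j: "(1/4::real)^j < e"
      using real_arch_pow_inv[of e "1/4"] by auto
    show "\<exists>n0. \<forall>n\<ge>n0. norm ((\<integral>x. (norm (u n x - v x))\<^sup>2 \<partial>M) - 0) < e"
      using bound[of j] j by (intro exI[of _ "r j"]) (auto intro: le_less_trans)
  qed
  with sv show ?thesis by blast
qed

section \<open>Integrals of products over coordinates\<close>

lemma sigma_finite_lebesgue: "sigma_finite_measure (lebesgue :: 'a::euclidean_space measure)"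
proof
  obtain A :: "'a set set" where A: "countable A" "A \<subseteq> sets lborel" "\<Union>A = space lborel" "\<forall>a\<in>A. emeasure lborel a \<noteq> \<infinity>"
    using lborel.sigma_finite_countable by blast
  have "emeasure lebesgue a = emeasure lborel a" if "a \<in> A" for a
    using A(2) that by (auto simp: main_part subset_iff)
  then show "\<exists>A::'a set set. countable A \<and> A \<subseteq> sets lebesgue \<and> \<Union>A = space lebesgue \<and> (\<forall>a\<in>A. emeasure lebesgue a \<noteq> \<infinity>)"
    using A by (intro exI[of _ A]) auto
qed

interpretation lebesgue: sigma_finite_measure lebesgue
  by (rule sigma_finite_lebesgue)

interpretation lebesgue_pair: pair_sigma_finite lebesgue lebesgue ..

lemma vec_nth_measurable [measurable]: "(\<lambda>x::real^'n. x $ k) \<in> borel_measurable borel"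
  by (intro borel_measurable_continuous_onI continuous_intros)

text \<open>
Lebesgue measure on \<open>real ^ 'n\<close> is the image of the product of one-dimensional measures indexed by
\<open>Basis\<close>; reindexing \<open>Basis\<close> by coordinates reduces the claim to the product measure.
\<close>
lemma integral_prod_coordinates:
  fixes f :: "'n::finite \<Rightarrow> real \<Rightarrow> complex"
  assumes f: "\<And>k. integrable lborel (f k)"
  shows "integrable lborel (\<lambda>x::real^'n. \<Prod>k\<in>UNIV. f k (x $ k))"
    and "(\<integral>x. (\<Prod>k\<in>UNIV. f k ((x::real^'n) $ k)) \<partial>lborel) = (\<Prod>k\<in>UNIV. \<integral>t. f k t \<partial>lborel)"
proof -
  let ?S = "\<lambda>g. \<Sum>b\<in>(Basis :: (real^'n) set). g b *\<^sub>R b"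
  let ?P = "\<Pi>\<^sub>M b\<in>(Basis :: (real^'n) set). (lborel :: real measure)"
  interpret product_sigma_finite "\<lambda>b::real^'n. lborel :: real measure" ..
  have bij: "bij_betw (\<lambda>k. axis k 1) (UNIV :: 'n set) (Basis :: (real^'n) set)"
    by (auto simp: bij_betw_def inj_on_def axis_eq_axis Basis_vec_def)
  have comp: "?S g $ k = g (axis k 1)" for g and k :: 'n
  proof -
    have "?S g \<bullet> axis k 1 = g (axis k 1)"
      by (subst inner_sum_left_Basis) (auto simp: axis_in_Basis_iff)
    then show ?thesis by (simp add: cart_eq_inner_axis)
  qed
  have eq: "(\<Prod>k\<in>UNIV. f k (?S g $ k)) = (\<Prod>b\<in>Basis. f (axis_index b) (g b))" for g
    unfolding comp by (subst prod.reindex_bij_betw[OF bij, symmetric]) simp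
  have [measurable]: "f k \<in> borel_measurable borel" for k
    using borel_measurable_integrable[OF f[of k]] by simp
  have meas: "(\<lambda>x::real^'n. \<Prod>k\<in>UNIV. f k (x $ k)) \<in> borel_measurable borel"
    by measurable
  have S: "?S \<in> measurable ?P borel" by measurable
  have lborel_P: "(lborel :: (real^'n) measure) = distr ?P borel ?S"
    by (rule lborel_eq)
  have int: "integrable ?P (\<lambda>g. \<Prod>b\<in>(Basis :: (real^'n) set). f (axis_index b) (g b))"
    by (rule product_integrable_prod) (auto intro: f)
  show "integrable lborel (\<lambda>x::real^'n. \<Prod>k\<in>UNIV. f k (x $ k))"
    unfolding lborel_P integrable_distr_eq[OF S meas] eq by (rule int)
  have "(\<integral>x. (\<Prod>k\<in>UNIV. f k ((x::real^'n) $ k)) \<partial>lborel) = (\<integral>g. (\<Prod>b\<in>Basis. f (axis_index b) (g b)) \<partial>?P)"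
    unfolding lborel_P integral_distr[OF S meas] eq ..
  also have "\<dots> = (\<Prod>b\<in>(Basis :: (real^'n) set). \<integral>t. f (axis_index b) t \<partial>lborel)"
    by (rule product_integral_prod) (auto intro: f)
  also have "\<dots> = (\<Prod>k\<in>UNIV. \<integral>t. f k t \<partial>lborel)"
    by (subst prod.reindex_bij_betw[OF bij, symmetric]) simp
  finally show "(\<integral>x. (\<Prod>k\<in>UNIV. f k ((x::real^'n) $ k)) \<partial>lborel) = (\<Prod>k\<in>UNIV. \<integral>t. f k t \<partial>lborel)" .
qed

section \<open>Gaussian densities\<close>

text \<open>
The characteristic function of the standard normal distribution at \<open>u / s\<close>, after the substitution
\<open>s b t\<close> for the variable.  The Gaussian is scaled by \<open>b\<close> as well as \<open>s\<close> so that the result is the same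
density for all \<open>b\<close>: the product over the coordinates is then rotation invariant.
\<close>
lemma Fourier_transform_gaussian:
  fixes b s u :: real
  assumes "b \<noteq> 0" "s > 0"
  shows "integrable lborel (\<lambda>t. cis (b * u * t) * of_real (exp (- (s * b * t)\<^sup>2 / 2)))" (is "integrable _ ?f")
    and "of_real (\<bar>b\<bar> / (2 * pi)) * (\<integral>t. cis (b * u * t) * of_real (exp (- (s * b * t)\<^sup>2 / 2)) \<partial>lborel)
      = of_real (normal_density 0 s u)"
proof -
  have sb: "s * b \<noteq> 0" using assms by simp
  \<comment> \<open>The integrand of the characteristic function at \<open>u / s\<close>, so that \<open>g (s b t)\<close> is a multiple of the
    integrand of the claim.\<close>
  define g where "g t = iexp (u / s * t) * of_real (std_normal_density t)" for t
  have [measurable]: "g \<in> borel_measurable borel"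
    unfolding g_def by measurable
  have "integrable lborel g"
    by (rule Bochner_Integration.integrable_bound[of _ "\<lambda>t. std_normal_density t"])
       (auto simp: g_def norm_mult)
  then have g: "has_bochner_integral lborel g (integral\<^sup>L lborel g)"
    by (rule has_bochner_integral_integrable)
  have "integral\<^sup>L lborel g = char std_normal_distribution (u / s)"
    unfolding char_def g_def
    by (subst integral_density) (auto simp: scaleR_conv_of_real mult.commute)
  also have "\<dots> = of_real (exp (- (u / s)\<^sup>2 / 2))"
    by (simp add: char_std_normal_distribution)
  finally have I: "integral\<^sup>L lborel g = of_real (exp (- (u / s)\<^sup>2 / 2))" .
  have gf: "g (0 + s * b * t) = of_real (1 / sqrt (2 * pi)) * ?f t" for t
  proof -
    have "u / s * (0 + s * b * t) = b * u * t" using assms by simp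
    then show ?thesis
      by (simp add: g_def std_normal_density_def cis_conv_exp)
  qed
  have "has_bochner_integral lborel (\<lambda>t. of_real (1 / sqrt (2 * pi)) * ?f t) (integral\<^sup>L lborel g /\<^sub>R \<bar>s * b\<bar>)"
    using g lborel_has_bochner_integral_real_affine_iff[OF sb, of g "integral\<^sup>L lborel g" 0]
    unfolding gf by blast
  then have "has_bochner_integral lborel (\<lambda>t. of_real (sqrt (2 * pi)) * (of_real (1 / sqrt (2 * pi)) * ?f t))
     (of_real (sqrt (2 * pi)) * (integral\<^sup>L lborel g /\<^sub>R \<bar>s * b\<bar>))"
    by (intro has_bochner_integral_mult_right) auto
  then have f: "has_bochner_integral lborel ?f
     (of_real (sqrt (2 * pi)) * (integral\<^sup>L lborel g /\<^sub>R \<bar>s * b\<bar>))"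
    by (simp add: mult.assoc[symmetric] flip: of_real_mult)
  then show "integrable lborel ?f"
    by (rule integrable.intros)
  have eq: "\<bar>b\<bar> / (2 * pi) * (sqrt (2 * pi) * (exp (- (u / s)\<^sup>2 / 2) / \<bar>s * b\<bar>)) = normal_density 0 s u"
  proof -
    have "2 * pi = sqrt (2 * pi) * sqrt (2 * pi)" by simp
    then have "\<bar>b\<bar> / (2 * pi) * (sqrt (2 * pi) * (exp (- (u / s)\<^sup>2 / 2) / \<bar>s * b\<bar>))
      = \<bar>b\<bar> / (sqrt (2 * pi) * sqrt (2 * pi)) * (sqrt (2 * pi) * (exp (- (u / s)\<^sup>2 / 2) / \<bar>s * b\<bar>))"
      by simp
    also have "\<dots> = 1 / (sqrt (2 * pi) * s) * exp (- (u / s)\<^sup>2 / 2)"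
      using assms by (simp add: abs_mult field_simps del: real_sqrt_mult_self)
    also have "\<dots> = normal_density 0 s u"
      using assms by (simp add: normal_density_def real_sqrt_mult power_divide)
    finally show ?thesis .
  qed
  show "of_real (\<bar>b\<bar> / (2 * pi)) * (\<integral>t. ?f t \<partial>lborel) = of_real (normal_density 0 s u)"
  proof -
    have div: "complex_of_real r /\<^sub>R c = of_real (r / c)" for r c
      by (simp add: scaleR_conv_of_real field_simps)
    show ?thesis
      unfolding has_bochner_integral_integral_eq[OF f] I div eq[symmetric] of_real_mult ..
  qed
qed

definition gauss :: "real \<Rightarrow> real ^ 'n \<Rightarrow> real" where
  "gauss s z = (\<Prod>k\<in>UNIV. normal_density 0 s (z $ k))"

lemma gauss_nonneg [simp]: "gauss s z \<ge> 0"
  unfolding gauss_def by (intro prod_nonneg) auto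

lemma gauss_eq_exp_norm:
  fixes z :: "real ^ 'n"
  assumes "s > 0"
  shows "gauss s z = (1 / sqrt (2 * pi * s\<^sup>2)) ^ CARD('n) * exp (- (norm z)\<^sup>2 / (2 * s\<^sup>2))"
proof -
  have "(norm z)\<^sup>2 = (\<Sum>k\<in>UNIV. (z $ k)\<^sup>2)"
    by (simp add: norm_vec_def L2_set_def sum_nonneg)
  then have "- (norm z)\<^sup>2 / (2 * s\<^sup>2) = (\<Sum>k\<in>UNIV. - (z $ k)\<^sup>2 / (2 * s\<^sup>2))"
    by (simp add: sum_negf sum_divide_distrib)
  moreover have "gauss s z = (\<Prod>k\<in>UNIV. (1 / sqrt (2 * pi * s\<^sup>2)) * exp (- (z $ k)\<^sup>2 / (2 * s\<^sup>2)))"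
    by (simp add: gauss_def normal_density_def)
  ultimately show ?thesis
    by (simp only: prod.distrib prod_constant exp_sum[OF finite])
qed

lemma gauss_minus_commute: "s > 0 \<Longrightarrow> gauss s (x - y) = gauss s (y - x)"
  by (simp add: gauss_eq_exp_norm norm_minus_commute)

lemma gauss_measurable [measurable]: "gauss s \<in> borel_measurable borel"
  unfolding gauss_def by measurable

text \<open>
Centring at \<open>y\<close> only moves the mean of each one-dimensional factor.
\<close>
lemma gauss_translate:
  fixes y :: "real ^ 'n"
  assumes "s > 0"
  shows "integrable lborel (\<lambda>x. gauss s (x - y))" "(\<integral>x. gauss s (x - y) \<partial>lborel) = 1"
proof -
  have eq: "complex_of_real (gauss s (x - y)) = (\<Prod>k\<in>UNIV. of_real (normal_density (y $ k) s (x $ k)))" for x :: "real ^ 'n"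
    by (simp add: gauss_def normal_density_def)
  have "integrable lborel (\<lambda>t. complex_of_real (normal_density (y $ k) s t))" for k
    using integrable_normal_density[OF assms] by (simp add: complex_of_real_integrable_eq)
  from integral_prod_coordinates[OF this]
  have *: "integrable lborel (\<lambda>x. complex_of_real (gauss s (x - y)))"
     "(\<integral>x. complex_of_real (gauss s (x - y)) \<partial>lborel) = 1"
    using integral_normal_density[OF assms] by (simp_all add: eq)
  then show "integrable lborel (\<lambda>x. gauss s (x - y))" "(\<integral>x. gauss s (x - y) \<partial>lborel) = 1"
    by (simp_all add: complex_of_real_integrable_eq)
qed

lemma gauss_translate_lebesgue:
  fixes y :: "real ^ 'n"
  assumes "s > 0"
  shows "integrable lebesgue (\<lambda>x. gauss s (x - y))" "(\<integral>x. gauss s (x - y) \<partial>lebesgue) = 1"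
  using gauss_translate[OF assms, of y] by (simp_all add: integrable_completion integral_completion)

section \<open>The kernel and its damped orthogonality relation\<close>

text \<open>
Principal square roots commute with conjugation off the negative real axis, and
\<open>b / (2 \<pi> i)\<close> is purely imaginary.
\<close>
lemma qpft_kernel_neg_eq_cnj: "qpft_kernel_neg \<Lambda> \<omega> x = cnj (qpft_kernel \<Lambda> \<omega> x)"
  unfolding qpft_kernel_neg_def qpft_kernel_def cnj_prod
proof (intro prod.cong refl)
  fix k :: 'a
  obtain a b c d e where L: "\<Lambda> $ k = (a, b, c, d, e)" by (cases "\<Lambda> $ k") auto
  have 1: "of_real b * \<i> / (2 * of_real pi) = cnj (of_real b / (2 * of_real pi * \<i>))"
    by (simp add: field_simps)
  have 2: "Im (of_real b / (2 * of_real pi * \<i>)) = - (b / (2 * pi))"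
    by (simp add: Im_divide power2_eq_square)
  have "csqrt (of_real b * \<i> / (2 * of_real pi)) = cnj (csqrt (of_real b / (2 * of_real pi * \<i>)))"
    unfolding 1
    using 2 by (cases "b = 0") (auto simp: complex_nonpos_Reals_iff cnj_csqrt)
  then show "(case \<Lambda> $ k of (a, b, c, d, e) \<Rightarrow>
        csqrt (of_real b * \<i> / (2 * of_real pi)) *
        exp (- \<i> * of_real (a * (x $ k)^2 + b * (x $ k) * (\<omega> $ k) + c * (\<omega> $ k)^2
                            + d * (x $ k) + e * (\<omega> $ k)))) =
      cnj (case \<Lambda> $ k of (a, b, c, d, e) \<Rightarrow>
        csqrt (of_real b / (2 * of_real pi * \<i>)) *
        exp (\<i> * of_real (a * (x $ k)^2 + b * (x $ k) * (\<omega> $ k) + c * (\<omega> $ k)^2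
                          + d * (x $ k) + e * (\<omega> $ k))))"
    unfolding L by (simp add: exp_cnj)
qed

text \<open>
The kernel has constant modulus because its exponents are purely imaginary.
\<close>
definition kernel_modulus :: "qpft_param ^ 'n \<Rightarrow> real" where
  "kernel_modulus \<Lambda> = (\<Prod>k\<in>UNIV. case \<Lambda> $ k of (a, b, c, d, e) \<Rightarrow> sqrt (\<bar>b\<bar> / (2 * pi)))"

lemma norm_qpft_kernel: "norm (qpft_kernel \<Lambda> \<omega> x) = kernel_modulus \<Lambda>"
  unfolding qpft_kernel_def kernel_modulus_def prod_norm[symmetric]
  by (intro prod.cong refl) (auto split: prod.split simp: norm_mult norm_divide)

lemma continuous_on_qpft_kernel [continuous_intros]:
  assumes "continuous_on A f" "continuous_on A g"
  shows "continuous_on A (\<lambda>z. qpft_kernel \<Lambda> (f z) (g z))"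
  unfolding qpft_kernel_def
proof (rule continuous_on_prod)
  fix k
  obtain a b c d e where "\<Lambda> $ k = (a, b, c, d, e)" by (cases "\<Lambda> $ k") auto
  then show "continuous_on A (\<lambda>z. case \<Lambda> $ k of (a, b, c, d, e) \<Rightarrow>
        csqrt (of_real b / (2 * of_real pi * \<i>)) *
        exp (\<i> * of_real (a * (g z $ k)^2 + b * (g z $ k) * (f z $ k) + c * (f z $ k)^2
                          + d * (g z $ k) + e * (f z $ k))))"
    by (auto intro!: continuous_intros assms)
qed

lemma qpft_kernel_measurable [measurable (raw)]:
  assumes [measurable]: "f \<in> borel_measurable M" "g \<in> borel_measurable M"
  shows "(\<lambda>z. qpft_kernel \<Lambda> (f z) (g z)) \<in> borel_measurable M"
proof -
  have "(\<lambda>p. qpft_kernel \<Lambda> (fst p) (snd p)) \<in> borel_measurable borel"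
    by (intro borel_measurable_continuous_onI continuous_intros)
  then have "(\<lambda>p. qpft_kernel \<Lambda> (fst p) (snd p)) \<in> borel_measurable (borel \<Otimes>\<^sub>M borel)"
    by (simp add: borel_prod)
  from measurable_compose[OF _ this, of "\<lambda>z. (f z, g z)" M] show ?thesis by simp
qed

text \<open>
The phase of the kernel that depends on \<open>x\<close> alone.  It has to be kept, whereas the phase that depends
on \<open>\<omega>\<close> alone cancels in a product \<open>K(\<omega>,x) cnj (K(\<omega>,y))\<close>.
\<close>
definition chirp :: "qpft_param ^ 'n \<Rightarrow> real ^ 'n \<Rightarrow> complex" where
  "chirp \<Lambda> x = (\<Prod>k\<in>UNIV. case \<Lambda> $ k of (a, b, c, d, e) \<Rightarrow> cis (a * (x $ k)\<^sup>2 + d * x $ k))"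

lemma norm_chirp [simp]: "norm (chirp \<Lambda> x) = 1"
  unfolding chirp_def prod_norm[symmetric] by (intro prod.neutral) (auto split: prod.split)

lemma chirp_mult_cnj [simp]: "chirp \<Lambda> x * cnj (chirp \<Lambda> x) = 1"
  using complex_norm_square[of "chirp \<Lambda> x"] by simp

lemma chirp_measurable [measurable]: "chirp \<Lambda> \<in> borel_measurable borel"
proof (rule borel_measurable_continuous_onI)
  show "continuous_on UNIV (chirp \<Lambda>)"
    unfolding chirp_def[abs_def]
  proof (rule continuous_on_prod)
    fix k
    obtain a b c d e where "\<Lambda> $ k = (a, b, c, d, e)" by (cases "\<Lambda> $ k") auto
    then show "continuous_on UNIV (\<lambda>x. case \<Lambda> $ k of (a, b, c, d, e) \<Rightarrow> cis (a * (x $ k)\<^sup>2 + d * x $ k))"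
      by (auto intro!: continuous_intros)
  qed
qed

text \<open>
The weight uses \<open>b\<close> of each coordinate to match \<open>Fourier_transform_gaussian\<close>.
\<close>
definition damp :: "qpft_param ^ 'n \<Rightarrow> real \<Rightarrow> real ^ 'n \<Rightarrow> real" where
  "damp \<Lambda> s \<omega> = (\<Prod>k\<in>UNIV. case \<Lambda> $ k of (a, b, c, d, e) \<Rightarrow> exp (- (s * b * \<omega> $ k)\<^sup>2 / 2))"

lemma damp_nonneg [simp]: "damp \<Lambda> s \<omega> \<ge> 0"
  unfolding damp_def by (intro prod_nonneg) (auto split: prod.split)

lemma damp_le_1 [simp]: "damp \<Lambda> s \<omega> \<le> 1"
  unfolding damp_def by (intro prod_le_1) (auto split: prod.split)

lemma damp_tendsto_1:
  assumes "\<sigma> \<longlonglongrightarrow> 0"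
  shows "(\<lambda>n. damp \<Lambda> (\<sigma> n) \<omega>) \<longlonglongrightarrow> 1"
proof -
  have "(\<lambda>n. damp \<Lambda> (\<sigma> n) \<omega>) \<longlonglongrightarrow> (\<Prod>k\<in>(UNIV::'a set). 1)"
    unfolding damp_def
  proof (rule tendsto_prod)
    fix k
    obtain a b c d e where L: "\<Lambda> $ k = (a, b, c, d, e)" by (cases "\<Lambda> $ k") auto
    have "(\<lambda>n. exp (- (\<sigma> n * b * \<omega> $ k)\<^sup>2 / 2)) \<longlonglongrightarrow> exp (- (0 * b * \<omega> $ k)\<^sup>2 / 2)"
      by (intro tendsto_intros assms) auto
    then show "(\<lambda>n. case \<Lambda> $ k of (a, b, c, d, e) \<Rightarrow> exp (- (\<sigma> n * b * \<omega> $ k)\<^sup>2 / 2)) \<longlonglongrightarrow> 1"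
      by (simp add: L)
  qed
  then show ?thesis by simp
qed

lemma damp_measurable [measurable]: "damp \<Lambda> s \<in> borel_measurable borel"
proof (rule borel_measurable_continuous_onI)
  show "continuous_on UNIV (damp \<Lambda> s)"
    unfolding damp_def[abs_def]
  proof (rule continuous_on_prod)
    fix k
    obtain a b c d e where "\<Lambda> $ k = (a, b, c, d, e)" by (cases "\<Lambda> $ k") auto
    then show "continuous_on UNIV (\<lambda>\<omega>. case \<Lambda> $ k of (a, b, c, d, e) \<Rightarrow> exp (- (s * b * \<omega> $ k)\<^sup>2 / 2))"
      by (auto intro!: continuous_intros)
  qed
qed

definition nondegenerate :: "qpft_param ^ 'n \<Rightarrow> bool" where
  "nondegenerate \<Lambda> \<longleftrightarrow> (\<forall>k. case \<Lambda> $ k of (a, b, c, d, e) \<Rightarrow> b \<noteq> 0)"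

text \<open>
The approximate orthogonality of the kernel functions: as \<open>s \<rightarrow> 0\<close> the right-hand side tends to a
point mass at \<open>x = y\<close>.  The chirps factor out of the integral, the terms in \<open>c\<close> and \<open>e\<close> cancel, and the
rest is a product of one-dimensional Gaussian Fourier transforms.
\<close>
lemma damped_kernel_integral:
  fixes \<Lambda> :: "qpft_param ^ 'n"
  assumes \<Lambda>: "nondegenerate \<Lambda>" and s: "s > 0"
  shows "integrable lebesgue (\<lambda>\<omega>. of_real (damp \<Lambda> s \<omega>) * (qpft_kernel \<Lambda> \<omega> x * cnj (qpft_kernel \<Lambda> \<omega> y)))"
    and "(\<integral>\<omega>. of_real (damp \<Lambda> s \<omega>) * (qpft_kernel \<Lambda> \<omega> x * cnj (qpft_kernel \<Lambda> \<omega> y)) \<partial>lebesgue)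
      = chirp \<Lambda> x * cnj (chirp \<Lambda> y) * of_real (gauss s (x - y))"
proof -
  define B where "B k = fst (snd (\<Lambda> $ k))" for k
  have B: "B k \<noteq> 0" for k
    using spec[OF \<Lambda>[unfolded nondegenerate_def], of k] by (simp add: B_def split_beta)
  define F where "F k t = cis (B k * (x $ k - y $ k) * t) * of_real (exp (- (s * B k * t)\<^sup>2 / 2))" for k t
  have eq: "of_real (damp \<Lambda> s \<omega>) * (qpft_kernel \<Lambda> \<omega> x * cnj (qpft_kernel \<Lambda> \<omega> y))
     = chirp \<Lambda> x * cnj (chirp \<Lambda> y) * (\<Prod>k\<in>UNIV. of_real (\<bar>B k\<bar> / (2 * pi)) * F k (\<omega> $ k))" for \<omega>
    unfolding damp_def qpft_kernel_def chirp_def cnj_prod of_real_prod prod.distrib[symmetric]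
  proof (intro prod.cong refl)
    fix k
    obtain a b c d e where L: "\<Lambda> $ k = (a, b, c, d, e)" by (cases "\<Lambda> $ k") auto
    let ?z = "csqrt (of_real b / (2 * of_real pi * \<i>))"
    have z: "?z * cnj ?z = of_real (\<bar>b\<bar> / (2 * pi))"
      unfolding complex_norm_square[symmetric] by (simp add: norm_divide norm_mult)
    define X where "X = x $ k"
    define Y where "Y = y $ k"
    define W where "W = \<omega> $ k"
    have e: "exp (\<i> * of_real t) = cis t" for t by (simp add: cis_conv_exp)
    have ph: "cis (a * X^2 + b * X * W + c * W^2 + d * X + e * W) * cnj (cis (a * Y^2 + b * Y * W + c * W^2 + d * Y + e * W))
      = cis (a * X^2 + d * X) * cnj (cis (a * Y^2 + d * Y)) * cis (b * (X - Y) * W)"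
      by (simp add: cis_mult cis_cnj algebra_simps)
    let ?r = "of_real (exp (- (s * b * W)\<^sup>2 / 2)) :: complex"
    have "?r * ((?z * cis (a * X^2 + b * X * W + c * W^2 + d * X + e * W)) *
          cnj (?z * cis (a * Y^2 + b * Y * W + c * W^2 + d * Y + e * W)))
        = ?r * ((?z * cnj ?z) * (cis (a * X^2 + b * X * W + c * W^2 + d * X + e * W)
           * cnj (cis (a * Y^2 + b * Y * W + c * W^2 + d * Y + e * W))))"
      by (simp only: complex_cnj_mult mult_ac)
    also have "\<dots> = cis (a * X^2 + d * X) * cnj (cis (a * Y^2 + d * Y)) * (of_real (\<bar>b\<bar> / (2 * pi)) * (cis (b * (X - Y) * W) * ?r))"
      unfolding z ph by (simp only: mult_ac)
    finally show "of_real (case \<Lambda> $ k of (a, b, c, d, e) \<Rightarrow> exp (- (s * b * \<omega> $ k)\<^sup>2 / 2)) *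
         ((case \<Lambda> $ k of (a, b, c, d, e) \<Rightarrow>
        csqrt (of_real b / (2 * of_real pi * \<i>)) *
        exp (\<i> * of_real (a * (x $ k)^2 + b * (x $ k) * (\<omega> $ k) + c * (\<omega> $ k)^2
                          + d * (x $ k) + e * (\<omega> $ k)))) *
        cnj (case \<Lambda> $ k of (a, b, c, d, e) \<Rightarrow>
        csqrt (of_real b / (2 * of_real pi * \<i>)) *
        exp (\<i> * of_real (a * (y $ k)^2 + b * (y $ k) * (\<omega> $ k) + c * (\<omega> $ k)^2
                          + d * (y $ k) + e * (\<omega> $ k))))) =
        (case \<Lambda> $ k of (a, b, c, d, e) \<Rightarrow> cis (a * (x $ k)\<^sup>2 + d * x $ k)) *
        cnj (case \<Lambda> $ k of (a, b, c, d, e) \<Rightarrow> cis (a * (y $ k)\<^sup>2 + d * y $ k)) *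
        (of_real (\<bar>B k\<bar> / (2 * pi)) * F k (\<omega> $ k))"
      unfolding L B_def F_def prod.case fst_conv snd_conv e X_def Y_def W_def .
  qed
  have F: "integrable lborel (\<lambda>t. of_real (\<bar>B k\<bar> / (2 * pi)) * F k t)"
    "(\<integral>t. of_real (\<bar>B k\<bar> / (2 * pi)) * F k t \<partial>lborel) = of_real (normal_density 0 s (x $ k - y $ k))" for k
    using Fourier_transform_gaussian[OF B[of k] s, of "x $ k - y $ k"]
    by (auto simp: F_def)
  note P = integral_prod_coordinates[OF F(1)]
  have meas: "(\<lambda>\<omega>. chirp \<Lambda> x * cnj (chirp \<Lambda> y) * (\<Prod>k\<in>UNIV. of_real (\<bar>B k\<bar> / (2 * pi)) * F k (\<omega> $ k))) \<in> borel_measurable lborel"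
    using borel_measurable_integrable[OF P(1)] by measurable
  show "integrable lebesgue (\<lambda>\<omega>. of_real (damp \<Lambda> s \<omega>) * (qpft_kernel \<Lambda> \<omega> x * cnj (qpft_kernel \<Lambda> \<omega> y)))"
    unfolding eq integrable_completion[OF meas] by (rule integrable_mult_right[OF P(1)])
  show "(\<integral>\<omega>. of_real (damp \<Lambda> s \<omega>) * (qpft_kernel \<Lambda> \<omega> x * cnj (qpft_kernel \<Lambda> \<omega> y)) \<partial>lebesgue)
      = chirp \<Lambda> x * cnj (chirp \<Lambda> y) * of_real (gauss s (x - y))"
    unfolding eq integral_completion[OF meas]
    by (subst integral_mult_right_zero) (simp only: P(2) F(2) gauss_def of_real_prod vector_minus_component)
qed

section \<open>Fubini for the kernel and for Gaussian convolution\<close>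

lemma L1_iff: "f \<in> L1 \<longleftrightarrow> integrable lebesgue f"
  by (simp add: L1_def)

lemma L2_iff: "f \<in> L2 \<longleftrightarrow> square_integrable lebesgue f"
  by (simp add: L2_def square_integrable_def)

lemma id_measurable_lebesgue_borel [measurable (raw)]: "(\<lambda>x. x) \<in> lebesgue \<rightarrow>\<^sub>M borel"
  by (rule measurable_completion) simp

lemma fst_measurable_lebesgue_borel [measurable]: "fst \<in> (lebesgue \<Otimes>\<^sub>M M) \<rightarrow>\<^sub>M borel"
  by (rule measurable_compose[OF measurable_fst id_measurable_lebesgue_borel])

lemma snd_measurable_lebesgue_borel [measurable]: "snd \<in> (M \<Otimes>\<^sub>M lebesgue) \<rightarrow>\<^sub>M borel"
  by (rule measurable_compose[OF measurable_snd id_measurable_lebesgue_borel])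

lemma cnj_measurable [measurable]: "cnj \<in> borel_measurable borel"
  by (intro borel_measurable_continuous_onI continuous_intros)

text \<open>
A bounded integrable function is square-integrable.
\<close>
lemma square_integrable_gauss:
  assumes s: "s > 0"
  shows "square_integrable lebesgue (\<lambda>x :: real ^ 'n. of_real (gauss s (x - y)))"
proof (rule square_integrable_bounded)
  let ?c = "(1 / sqrt (2 * pi * s\<^sup>2)) ^ CARD('n)"
  show "integrable lebesgue (\<lambda>x :: real ^ 'n. ?c * gauss s (x - y))"
    by (intro integrable_mult_right gauss_translate_lebesgue s)
  show "(norm (complex_of_real (gauss s (x - y))))\<^sup>2 \<le> ?c * gauss s (x - y)" for x :: "real ^ 'n"
  proof -
    have "gauss s (x - y) \<le> ?c * 1"
      unfolding gauss_eq_exp_norm[OF s] by (intro mult_left_mono) auto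
    then have "gauss s (x - y) * gauss s (x - y) \<le> ?c * gauss s (x - y)"
      by (intro mult_right_mono) auto
    then show ?thesis
      by (simp add: power2_eq_square)
  qed
qed measurable

lemma (in pair_sigma_finite) integrable_tensor:
  fixes u :: "'a \<Rightarrow> real" and v :: "'b \<Rightarrow> real"
  assumes u: "integrable M1 u" and v: "integrable M2 v"
  shows "integrable (M1 \<Otimes>\<^sub>M M2) (\<lambda>p. u (fst p) * v (snd p))"
proof (rule Fubini_integrable)
  note [measurable] = borel_measurable_integrable[OF u] borel_measurable_integrable[OF v]
  show "(\<lambda>p. u (fst p) * v (snd p)) \<in> borel_measurable (M1 \<Otimes>\<^sub>M M2)"
    by measurable
  show "integrable M1 (\<lambda>x. \<integral>y. norm (u (fst (x, y)) * v (snd (x, y))) \<partial>M2)"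
    using u by (simp add: abs_mult)
  show "AE x in M1. integrable M2 (\<lambda>y. u (fst (x, y)) * v (snd (x, y)))"
    using v by simp
qed

text \<open>
Tonelli: \<open>u\<close> in one variable times a probability density in the difference has total mass \<open>\<integral> u\<close>,
whichever of the two variables \<open>u\<close> depends on.
\<close>
lemma gauss_tensor:
  fixes u :: "real ^ 'n \<Rightarrow> real"
  assumes u: "integrable lebesgue u" and s: "s > 0"
  shows "integrable (lebesgue \<Otimes>\<^sub>M lebesgue) (\<lambda>p. u (fst p) * gauss s (fst p - snd p))" (is ?I1)
    and "(\<integral>p. u (fst p) * gauss s (fst p - snd p) \<partial>(lebesgue \<Otimes>\<^sub>M lebesgue)) = (\<integral>x. u x \<partial>lebesgue)" (is ?E1)
    and "integrable (lebesgue \<Otimes>\<^sub>M lebesgue) (\<lambda>p. u (snd p) * gauss s (fst p - snd p))" (is ?I2)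
    and "(\<integral>p. u (snd p) * gauss s (fst p - snd p) \<partial>(lebesgue \<Otimes>\<^sub>M lebesgue)) = (\<integral>x. u x \<partial>lebesgue)" (is ?E2)
proof -
  note [measurable] = borel_measurable_integrable[OF u]
  note g = gauss_translate_lebesgue[OF s]
  have g': "integrable lebesgue (\<lambda>y. gauss s (x - y))" "(\<integral>y. gauss s (x - y) \<partial>lebesgue) = 1" for x :: "real ^ 'n"
    using g[of x] by (simp_all add: gauss_minus_commute[OF s, of x])
  show ?I1
  proof (rule lebesgue_pair.Fubini_integrable)
    show "(\<lambda>p. u (fst p) * gauss s (fst p - snd p)) \<in> borel_measurable (lebesgue \<Otimes>\<^sub>M lebesgue)"
      by measurable
    show "integrable lebesgue (\<lambda>x. \<integral>y. norm (u (fst (x, y)) * gauss s (fst (x, y) - snd (x, y))) \<partial>lebesgue)"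
      using u by (simp add: abs_mult g')
    show "AE x in lebesgue. integrable lebesgue (\<lambda>y. u (fst (x, y)) * gauss s (fst (x, y) - snd (x, y)))"
      by (simp add: g')
  qed
  from lebesgue_pair.integral_fst'[OF this] show ?E1
    by (simp add: g')
  from lebesgue_pair.integrable_product_swap[OF \<open>?I1\<close>] show ?I2
    by (simp add: case_prod_beta' gauss_minus_commute[OF s])
  have "integrable (lebesgue \<Otimes>\<^sub>M lebesgue) (\<lambda>(x, y). u y * gauss s (x - y))"
    using \<open>?I2\<close> by (simp add: case_prod_beta')
  from lebesgue_pair.integral_snd[OF this] show ?E2
    by (simp add: g case_prod_beta')
qed

lemma kernel_modulus_pos: "nondegenerate \<Lambda> \<Longrightarrow> kernel_modulus \<Lambda> > 0"
  unfolding kernel_modulus_def nondegenerate_def split_beta by (intro prod_pos) simp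

lemma kernel_modulus_nonneg [simp]: "kernel_modulus \<Lambda> \<ge> 0"
  by (metis norm_ge_zero norm_qpft_kernel)

text \<open>
The case \<open>x = y\<close> of \<open>damped_kernel_integral\<close>, where the two kernels multiply to a positive constant.
\<close>
lemma integrable_damp:
  fixes \<Lambda> :: "qpft_param ^ 'n"
  assumes "nondegenerate \<Lambda>" "s > 0"
  shows "integrable lebesgue (damp \<Lambda> s)"
proof -
  have "integrable lebesgue (\<lambda>\<omega>. norm (of_real (damp \<Lambda> s \<omega>) * (qpft_kernel \<Lambda> \<omega> 0 * cnj (qpft_kernel \<Lambda> \<omega> 0))))"
    by (rule integrable_norm[OF damped_kernel_integral(1)[OF assms]])
  then have "integrable lebesgue (\<lambda>\<omega>. damp \<Lambda> s \<omega> * (kernel_modulus \<Lambda>)\<^sup>2)"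
    by (simp add: norm_mult norm_qpft_kernel power2_eq_square)
  then have "integrable lebesgue (\<lambda>\<omega>. damp \<Lambda> s \<omega> * (kernel_modulus \<Lambda>)\<^sup>2 * (1 / (kernel_modulus \<Lambda>)\<^sup>2))"
    by (rule integrable_mult_left)
  then show ?thesis
    using kernel_modulus_pos[OF assms(1)] by simp
qed

section \<open>The transform of integrable functions is a contraction in mean square\<close>

lemma integrable_kernel_mult:
  assumes "integrable lebesgue f"
  shows "integrable lebesgue (\<lambda>x. qpft_kernel \<Lambda> \<omega> x * f x)"
proof (rule Bochner_Integration.integrable_bound)
  note [measurable] = borel_measurable_integrable[OF assms]
  show "integrable lebesgue (\<lambda>x. kernel_modulus \<Lambda> * norm (f x))"
    using assms by auto
  show "(\<lambda>x. qpft_kernel \<Lambda> \<omega> x * f x) \<in> borel_measurable lebesgue"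
    by measurable
qed (auto simp: norm_mult norm_qpft_kernel)

lemma norm_qpft_L1_le:
  assumes "integrable lebesgue f"
  shows "norm (qpft_L1 \<Lambda> f \<omega>) \<le> kernel_modulus \<Lambda> * (\<integral>x. norm (f x) \<partial>lebesgue)"
  unfolding qpft_L1_def
  using integral_norm_bound[of lebesgue "\<lambda>x. qpft_kernel \<Lambda> \<omega> x * f x"]
  by (simp add: norm_mult norm_qpft_kernel)

lemma qpft_L1_measurable:
  assumes "integrable lebesgue f"
  shows "qpft_L1 \<Lambda> f \<in> borel_measurable lebesgue"
proof -
  note [measurable] = borel_measurable_integrable[OF assms]
  have "(\<lambda>(\<omega>, x). qpft_kernel \<Lambda> \<omega> x * f x) \<in> borel_measurable (lebesgue \<Otimes>\<^sub>M lebesgue)"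
    unfolding split_beta by measurable
  then show ?thesis
    unfolding qpft_L1_def[abs_def] by (rule lebesgue.borel_measurable_lebesgue_integral)
qed

lemma qpft_L1_diff:
  assumes "integrable lebesgue f" "integrable lebesgue g"
  shows "qpft_L1 \<Lambda> (\<lambda>x. f x - g x) \<omega> = qpft_L1 \<Lambda> f \<omega> - qpft_L1 \<Lambda> g \<omega>"
  unfolding qpft_L1_def right_diff_distrib
  by (intro Bochner_Integration.integral_diff integrable_kernel_mult assms)

text \<open>
Interchange of the integrals over \<open>\<omega>\<close> and \<open>x\<close>, justified by the damping, followed by
\<open>damped_kernel_integral\<close>.
\<close>
lemma damped_inversion_L1:
  fixes \<Lambda> :: "qpft_param ^ 'n"
  assumes \<Lambda>: "nondegenerate \<Lambda>" and s: "s > 0" and f: "integrable lebesgue f"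
  shows "(\<integral>\<omega>. qpft_L1 \<Lambda> f \<omega> * (of_real (damp \<Lambda> s \<omega>) * cnj (qpft_kernel \<Lambda> \<omega> y)) \<partial>lebesgue)
    = (\<integral>x. f x * (chirp \<Lambda> x * cnj (chirp \<Lambda> y) * of_real (gauss s (x - y))) \<partial>lebesgue)"
proof -
  note [measurable] = borel_measurable_integrable[OF f]
  define G where "G \<omega> x = f x * (of_real (damp \<Lambda> s \<omega>) * (qpft_kernel \<Lambda> \<omega> x * cnj (qpft_kernel \<Lambda> \<omega> y)))" for \<omega> x
  have G: "integrable (lebesgue \<Otimes>\<^sub>M lebesgue) (\<lambda>p. G (fst p) (snd p))"
  proof (rule Bochner_Integration.integrable_bound)
    show "integrable (lebesgue \<Otimes>\<^sub>M lebesgue)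
       (\<lambda>p. damp \<Lambda> s (fst p) * ((kernel_modulus \<Lambda>)\<^sup>2 * norm (f (snd p))))"
      by (rule lebesgue_pair.integrable_tensor[OF integrable_damp[OF \<Lambda> s]]) (use f in auto)
    show "(\<lambda>p. G (fst p) (snd p)) \<in> borel_measurable (lebesgue \<Otimes>\<^sub>M lebesgue)"
      unfolding G_def by measurable
  qed (auto simp: G_def norm_mult norm_qpft_kernel power2_eq_square)
  have "(\<integral>\<omega>. qpft_L1 \<Lambda> f \<omega> * (of_real (damp \<Lambda> s \<omega>) * cnj (qpft_kernel \<Lambda> \<omega> y)) \<partial>lebesgue)
      = (\<integral>\<omega>. (\<integral>x. G \<omega> x \<partial>lebesgue) \<partial>lebesgue)"
    unfolding qpft_L1_def integral_mult_left_zero[symmetric] G_def by (simp add: mult_ac)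
  also have "\<dots> = (\<integral>x. (\<integral>\<omega>. G \<omega> x \<partial>lebesgue) \<partial>lebesgue)"
    using lebesgue_pair.Fubini_integral[of G] G by (simp add: case_prod_beta')
  also have "\<dots> = (\<integral>x. f x * (chirp \<Lambda> x * cnj (chirp \<Lambda> y) * of_real (gauss s (x - y))) \<partial>lebesgue)"
    unfolding G_def integral_mult_right_zero damped_kernel_integral(2)[OF \<Lambda> s] ..
  finally show ?thesis .
qed

text \<open>
Expanding \<open>cnj (Q f)\<close> as an integral over \<open>y\<close> and applying \<open>damped_inversion_L1\<close> to the inner
integral turns the damped energy into the double integral of
\<open>f(x) cnj (f(y)) g\<^sub>s(x - y)\<close> times a unimodular factor.  This is dominated by
\<open>(\<bar>f(x)\<bar>\<^sup>2 + \<bar>f(y)\<bar>\<^sup>2) / 2 g\<^sub>s(x - y)\<close>, whose integral is the energy of \<open>f\<close> since \<open>g\<^sub>s\<close> has mass 1.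
\<close>
lemma damped_energy_le:
  fixes \<Lambda> :: "qpft_param ^ 'n"
  assumes \<Lambda>: "nondegenerate \<Lambda>" and s: "s > 0" and f: "integrable lebesgue f" and f2: "square_integrable lebesgue f"
  shows "integrable lebesgue (\<lambda>\<omega>. damp \<Lambda> s \<omega> * (norm (qpft_L1 \<Lambda> f \<omega>))\<^sup>2)"
    and "(\<integral>\<omega>. damp \<Lambda> s \<omega> * (norm (qpft_L1 \<Lambda> f \<omega>))\<^sup>2 \<partial>lebesgue) \<le> (\<integral>x. (norm (f x))\<^sup>2 \<partial>lebesgue)"
proof -
  note [measurable] = borel_measurable_integrable[OF f] qpft_L1_measurable[OF f]
  define h where "h = qpft_L1 \<Lambda> f"
  have [measurable]: "h \<in> borel_measurable lebesgue"
    unfolding h_def by measurable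
  define C where "C = kernel_modulus \<Lambda> * (\<integral>x. norm (f x) \<partial>lebesgue)"
  have hC: "norm (h \<omega>) \<le> C" for \<omega>
    unfolding h_def C_def by (rule norm_qpft_L1_le[OF f])
  show "integrable lebesgue (\<lambda>\<omega>. damp \<Lambda> s \<omega> * (norm (qpft_L1 \<Lambda> f \<omega>))\<^sup>2)"
  proof (rule Bochner_Integration.integrable_bound)
    show "integrable lebesgue (\<lambda>\<omega>. damp \<Lambda> s \<omega> * C\<^sup>2)"
      by (intro integrable_mult_left integrable_damp \<Lambda> s)
  qed (auto simp: abs_mult h_def[symmetric] intro!: AE_I2 mult_left_mono power_mono hC)
  define G where "G \<omega> y = cnj (f y) * (h \<omega> * (of_real (damp \<Lambda> s \<omega>) * cnj (qpft_kernel \<Lambda> \<omega> y)))" for \<omega> y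
  have G: "integrable (lebesgue \<Otimes>\<^sub>M lebesgue) (\<lambda>p. G (fst p) (snd p))"
  proof (rule Bochner_Integration.integrable_bound)
    show "integrable (lebesgue \<Otimes>\<^sub>M lebesgue)
       (\<lambda>p. damp \<Lambda> s (fst p) * (C * kernel_modulus \<Lambda> * norm (f (snd p))))"
      by (rule lebesgue_pair.integrable_tensor[OF integrable_damp[OF \<Lambda> s]]) (use f in auto)
    show "(\<lambda>p. G (fst p) (snd p)) \<in> borel_measurable (lebesgue \<Otimes>\<^sub>M lebesgue)"
      unfolding G_def by measurable
    show "AE p in lebesgue \<Otimes>\<^sub>M lebesgue. norm (G (fst p) (snd p))
        \<le> norm (damp \<Lambda> s (fst p) * (C * kernel_modulus \<Lambda> * norm (f (snd p))))"
    proof (intro AE_I2)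
      fix p :: "(real^'n) \<times> (real^'n)"
      have "norm (G (fst p) (snd p)) = norm (h (fst p)) * (damp \<Lambda> s (fst p) * kernel_modulus \<Lambda> * norm (f (snd p)))"
        by (simp add: G_def norm_mult norm_qpft_kernel)
      also have "\<dots> \<le> C * (damp \<Lambda> s (fst p) * kernel_modulus \<Lambda> * norm (f (snd p)))"
        by (intro mult_right_mono hC) simp
      also have "\<dots> = damp \<Lambda> s (fst p) * (C * kernel_modulus \<Lambda> * norm (f (snd p)))"
        by simp
      also have "\<dots> \<le> norm \<dots>" by simp
      finally show "norm (G (fst p) (snd p))
        \<le> norm (damp \<Lambda> s (fst p) * (C * kernel_modulus \<Lambda> * norm (f (snd p))))" .
    qed
  qed
  have cnj_h: "cnj (h \<omega>) = (\<integral>y. cnj (f y) * cnj (qpft_kernel \<Lambda> \<omega> y) \<partial>lebesgue)" for \<omega>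
    unfolding h_def qpft_L1_def by (simp flip: Bochner_Integration.integral_cnj add: mult.commute)
  define E where "E p = cnj (f (snd p)) * (f (fst p) * (chirp \<Lambda> (fst p) * cnj (chirp \<Lambda> (snd p)) * of_real (gauss s (fst p - snd p))))"
    for p
  define P where "P p = (norm (f (fst p)))\<^sup>2 / 2 * gauss s (fst p - snd p) + (norm (f (snd p)))\<^sup>2 / 2 * gauss s (fst p - snd p)" for p
  have f2': "integrable lebesgue (\<lambda>x. (norm (f x))\<^sup>2 / 2)"
    using square_integrableD(2)[OF f2] by simp
  note GT = gauss_tensor[OF f2' s]
  have P: "integrable (lebesgue \<Otimes>\<^sub>M lebesgue) P"
    unfolding P_def[abs_def] by (intro Bochner_Integration.integrable_add GT)
  have EP: "norm (E p) \<le> P p" for p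
  proof -
    have "norm (E p) = (norm (f (fst p)) * norm (f (snd p))) * gauss s (fst p - snd p)"
      by (simp add: E_def norm_mult)
    also have "\<dots> \<le> ((norm (f (fst p)))\<^sup>2 / 2 + (norm (f (snd p)))\<^sup>2 / 2) * gauss s (fst p - snd p)"
      using sum_squares_bound[of "norm (f (fst p))" "norm (f (snd p))"]
      by (intro mult_right_mono) auto
    finally show ?thesis by (simp add: P_def algebra_simps)
  qed
  have E: "integrable (lebesgue \<Otimes>\<^sub>M lebesgue) E"
  proof (rule Bochner_Integration.integrable_bound[OF P])
    show "E \<in> borel_measurable (lebesgue \<Otimes>\<^sub>M lebesgue)"
      unfolding E_def[abs_def] by measurable
  qed (auto intro!: AE_I2 order_trans[OF EP])
  have "complex_of_real (\<integral>\<omega>. damp \<Lambda> s \<omega> * (norm (h \<omega>))\<^sup>2 \<partial>lebesgue)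
      = (\<integral>\<omega>. of_real (damp \<Lambda> s \<omega>) * (h \<omega> * cnj (h \<omega>)) \<partial>lebesgue)"
    unfolding integral_complex_of_real[symmetric] by (simp only: of_real_mult complex_norm_square)
  also have "\<dots> = (\<integral>\<omega>. (\<integral>y. G \<omega> y \<partial>lebesgue) \<partial>lebesgue)"
    unfolding G_def by (simp add: cnj_h mult_ac flip: integral_mult_right_zero integral_mult_left_zero)
  also have "\<dots> = (\<integral>y. (\<integral>\<omega>. G \<omega> y \<partial>lebesgue) \<partial>lebesgue)"
    using lebesgue_pair.Fubini_integral[of G] G by (simp add: case_prod_beta')
  also have "\<dots> = (\<integral>y. (\<integral>x. E (x, y) \<partial>lebesgue) \<partial>lebesgue)"
    unfolding G_def h_def E_def integral_mult_right_zero damped_inversion_L1[OF \<Lambda> s f] fst_conv snd_conv ..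
  also have "\<dots> = (\<integral>p. E p \<partial>(lebesgue \<Otimes>\<^sub>M lebesgue))"
    using lebesgue_pair.integral_snd[of "\<lambda>x y. E (x, y)"] E by simp
  finally have "norm (complex_of_real (\<integral>\<omega>. damp \<Lambda> s \<omega> * (norm (h \<omega>))\<^sup>2 \<partial>lebesgue)) = norm (\<integral>p. E p \<partial>(lebesgue \<Otimes>\<^sub>M lebesgue))"
    by simp
  also have "\<dots> \<le> (\<integral>p. norm (E p) \<partial>(lebesgue \<Otimes>\<^sub>M lebesgue))"
    by (rule integral_norm_bound)
  also have "\<dots> \<le> (\<integral>p. P p \<partial>(lebesgue \<Otimes>\<^sub>M lebesgue))"
    by (intro integral_mono integrable_norm E P EP)
  also have "\<dots> = (\<integral>x. (norm (f x))\<^sup>2 \<partial>lebesgue)"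
    unfolding P_def using GT by simp
  finally show "(\<integral>\<omega>. damp \<Lambda> s \<omega> * (norm (qpft_L1 \<Lambda> f \<omega>))\<^sup>2 \<partial>lebesgue) \<le> (\<integral>x. (norm (f x))\<^sup>2 \<partial>lebesgue)"
    by (simp add: h_def)
qed

text \<open>
Half of Plancherel's theorem, from \<open>damped_energy_le\<close> by letting the damping tend to 1.  The bound
does not depend on \<open>s\<close>, so Fatou's lemma applies.
\<close>
lemma Plancherel_bound:
  fixes \<Lambda> :: "qpft_param ^ 'n"
  assumes \<Lambda>: "nondegenerate \<Lambda>" and f: "integrable lebesgue f" and f2: "square_integrable lebesgue f"
  shows "square_integrable lebesgue (qpft_L1 \<Lambda> f)"
    and "(\<integral>\<omega>. (norm (qpft_L1 \<Lambda> f \<omega>))\<^sup>2 \<partial>lebesgue) \<le> (\<integral>x. (norm (f x))\<^sup>2 \<partial>lebesgue)"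
proof -
  note [measurable] = qpft_L1_measurable[OF f]
  define \<sigma> where "\<sigma> n = inverse (real (Suc n))" for n
  have \<sigma>: "\<sigma> n > 0" "\<sigma> \<longlonglongrightarrow> 0" for n
    using LIMSEQ_inverse_real_of_nat by (simp_all add: \<sigma>_def[abs_def])
  let ?h = "\<lambda>\<omega>. (norm (qpft_L1 \<Lambda> f \<omega>))\<^sup>2"
  have "(\<integral>\<^sup>+\<omega>. ennreal (?h \<omega>) \<partial>lebesgue) = (\<integral>\<^sup>+\<omega>. liminf (\<lambda>n. ennreal (damp \<Lambda> (\<sigma> n) \<omega> * ?h \<omega>)) \<partial>lebesgue)"
  proof (intro nn_integral_cong)
    fix \<omega>
    have "(\<lambda>n. ennreal (damp \<Lambda> (\<sigma> n) \<omega> * ?h \<omega>)) \<longlonglongrightarrow> ennreal (1 * ?h \<omega>)"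
      by (intro tendsto_intros damp_tendsto_1 \<sigma>)
    then show "ennreal (?h \<omega>) = liminf (\<lambda>n. ennreal (damp \<Lambda> (\<sigma> n) \<omega> * ?h \<omega>))"
      by (intro lim_imp_Liminf[symmetric]) simp_all
  qed
  also have "\<dots> \<le> liminf (\<lambda>n. \<integral>\<^sup>+\<omega>. ennreal (damp \<Lambda> (\<sigma> n) \<omega> * ?h \<omega>) \<partial>lebesgue)"
    by (rule nn_integral_liminf) measurable
  also have "\<dots> \<le> liminf (\<lambda>n::nat. ennreal (\<integral>x. (norm (f x))\<^sup>2 \<partial>lebesgue))"
  proof (intro Liminf_mono always_eventually allI)
    fix n
    show "(\<integral>\<^sup>+\<omega>. ennreal (damp \<Lambda> (\<sigma> n) \<omega> * ?h \<omega>) \<partial>lebesgue) \<le> ennreal (\<integral>x. (norm (f x))\<^sup>2 \<partial>lebesgue)"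
      using damped_energy_le[OF \<Lambda> \<sigma>(1) f f2, of n]
      by (subst nn_integral_eq_integral) (auto intro: ennreal_leI)
  qed
  also have "\<dots> = ennreal (\<integral>x. (norm (f x))\<^sup>2 \<partial>lebesgue)"
    by (simp add: Liminf_const)
  finally have le: "(\<integral>\<^sup>+\<omega>. ennreal (?h \<omega>) \<partial>lebesgue) \<le> ennreal (\<integral>x. (norm (f x))\<^sup>2 \<partial>lebesgue)" .
  show sq: "square_integrable lebesgue (qpft_L1 \<Lambda> f)"
    unfolding square_integrable_def using le
    by (auto intro!: integrableI_nonneg intro: le_less_trans)
  show "(\<integral>\<omega>. (norm (qpft_L1 \<Lambda> f \<omega>))\<^sup>2 \<partial>lebesgue) \<le> (\<integral>x. (norm (f x))\<^sup>2 \<partial>lebesgue)"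
    using le nn_integral_eq_integral[OF square_integrableD(2)[OF sq]] by (simp add: ennreal_le_iff)
qed

section \<open>The continuous extension\<close>

definition truncate :: "nat \<Rightarrow> (real ^ 'n \<Rightarrow> complex) \<Rightarrow> real ^ 'n \<Rightarrow> complex" where
  "truncate n f x = indicator (cball 0 (real n)) x *\<^sub>R f x"

lemma truncate:
  fixes f :: "real ^ 'n \<Rightarrow> complex"
  assumes f: "square_integrable lebesgue f"
  shows "integrable lebesgue (truncate n f)"
    and "square_integrable lebesgue (truncate n f)"
    and "(\<lambda>n. \<integral>x. (norm (truncate n f x - f x))\<^sup>2 \<partial>lebesgue) \<longlonglongrightarrow> 0"
proof -
  note [measurable] = square_integrableD(1)[OF f]
  have [measurable]: "cball 0 r \<in> sets (lebesgue :: (real^'n) measure)" for r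
    by simp
  have m[measurable]: "truncate n f \<in> borel_measurable lebesgue" for n
    unfolding truncate_def[abs_def] by measurable
  show "integrable lebesgue (truncate n f)"
  proof (rule Bochner_Integration.integrable_bound[OF _ m])
    have "emeasure lebesgue (cball (0::real^'n) n) < \<infinity>"
      using emeasure_bounded_finite[OF bounded_cball] by simp
    then have "integrable lebesgue (indicator (cball (0::real^'n) n) :: _ \<Rightarrow> real)"
      by simp
    then show "integrable lebesgue (\<lambda>x. indicator (cball (0::real^'n) n) x + (norm (f x))\<^sup>2)"
      using square_integrableD(2)[OF f] by auto
    show "AE x in lebesgue. norm (truncate n f x) \<le> norm (indicator (cball 0 (real n)) x + (norm (f x))\<^sup>2)"
    proof (intro AE_I2)
      fix x
      show "norm (truncate n f x) \<le> norm (indicator (cball 0 (real n)) x + (norm (f x))\<^sup>2)"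
        using norm_le_power2_plus_1[of "f x"] by (auto simp: truncate_def indicator_def)
    qed
  qed
  show "square_integrable lebesgue (truncate n f)"
    by (rule square_integrable_bounded[OF m square_integrableD(2)[OF f]]) (simp add: truncate_def indicator_def)
  have "(\<lambda>n. \<integral>x. (norm (truncate n f x - f x))\<^sup>2 \<partial>lebesgue) \<longlonglongrightarrow> (\<integral>x. 0 \<partial>(lebesgue :: (real^'n) measure))"
  proof (rule integral_dominated_convergence)
    show "integrable lebesgue (\<lambda>x. (norm (f x))\<^sup>2)"
      by (rule square_integrableD(2)[OF f])
    show "AE x in lebesgue. (\<lambda>n. (norm (truncate n f x - f x))\<^sup>2) \<longlonglongrightarrow> 0"
    proof (intro AE_I2 tendsto_eventually)
      fix x :: "real ^ 'n"
      obtain N where "norm x \<le> real N" using real_arch_simple by blast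
      then show "\<forall>\<^sub>F n in sequentially. (norm (truncate n f x - f x))\<^sup>2 = 0"
        by (intro eventually_sequentiallyI[of N]) (auto simp: truncate_def indicator_def)
    qed
  qed (auto simp: truncate_def indicator_def)
  then show "(\<lambda>n. \<integral>x. (norm (truncate n f x - f x))\<^sup>2 \<partial>lebesgue) \<longlonglongrightarrow> 0"
    by simp
qed

definition L2_limit :: "(nat \<Rightarrow> real ^ 'n \<Rightarrow> complex) \<Rightarrow> (real ^ 'n \<Rightarrow> complex) \<Rightarrow> bool" where
  "L2_limit u v \<longleftrightarrow> square_integrable lebesgue v \<and> (\<lambda>n. \<integral>x. (norm (u n x - v x))\<^sup>2 \<partial>lebesgue) \<longlonglongrightarrow> 0"

lemma qpft_L1_diff_bound:
  fixes \<Lambda> :: "qpft_param ^ 'n"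
  assumes \<Lambda>: "nondegenerate \<Lambda>"
    and "integrable lebesgue f" "square_integrable lebesgue f" "integrable lebesgue g" "square_integrable lebesgue g"
  shows "(\<integral>\<omega>. (norm (qpft_L1 \<Lambda> f \<omega> - qpft_L1 \<Lambda> g \<omega>))\<^sup>2 \<partial>lebesgue) \<le> (\<integral>x. (norm (f x - g x))\<^sup>2 \<partial>lebesgue)"
proof -
  have "(\<integral>\<omega>. (norm (qpft_L1 \<Lambda> (\<lambda>x. f x - g x) \<omega>))\<^sup>2 \<partial>lebesgue) \<le> (\<integral>x. (norm (f x - g x))\<^sup>2 \<partial>lebesgue)"
    by (intro Plancherel_bound \<Lambda> square_integrable_diff Bochner_Integration.integrable_diff assms)
  then show ?thesis by (simp add: qpft_L1_diff assms)
qed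

text \<open>
The truncations converge to \<open>f\<close> in mean square; since the transform contracts distances, their
transforms form a Cauchy sequence.
\<close>
lemma ex_L2_limit_qpft:
  fixes \<Lambda> :: "qpft_param ^ 'n"
  assumes \<Lambda>: "nondegenerate \<Lambda>" and f: "square_integrable lebesgue f"
  shows "\<exists>v. L2_limit (\<lambda>n. qpft_L1 \<Lambda> (truncate n f)) v"
  unfolding L2_limit_def
proof (rule Riesz_Fischer)
  show "square_integrable lebesgue (qpft_L1 \<Lambda> (truncate n f))" for n
    by (intro Plancherel_bound \<Lambda> truncate f)
  fix e :: real assume "e > 0"
  have sd: "square_integrable lebesgue (\<lambda>x. truncate m f x - f x)" for m
    by (intro square_integrable_diff truncate f)
  have "\<forall>\<^sub>F n in sequentially. (\<integral>x. (norm (truncate n f x - f x))\<^sup>2 \<partial>lebesgue) < e / 4"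
    using order_tendstoD(2)[OF truncate(3)[OF f], of "e/4"] \<open>e > 0\<close> by simp
  then obtain N where N: "\<And>n. n \<ge> N \<Longrightarrow> (\<integral>x. (norm (truncate n f x - f x))\<^sup>2 \<partial>lebesgue) < e / 4"
    by (auto simp: eventually_sequentially)
  show "\<exists>N. \<forall>m\<ge>N. \<forall>n\<ge>N. (\<integral>x. (norm (qpft_L1 \<Lambda> (truncate m f) x - qpft_L1 \<Lambda> (truncate n f) x))\<^sup>2 \<partial>lebesgue) < e"
  proof (intro exI[of _ N] allI impI)
    fix m n assume mn: "m \<ge> N" "n \<ge> N"
    have "(\<integral>x. (norm (qpft_L1 \<Lambda> (truncate m f) x - qpft_L1 \<Lambda> (truncate n f) x))\<^sup>2 \<partial>lebesgue)
      \<le> (\<integral>x. (norm (truncate m f x - truncate n f x))\<^sup>2 \<partial>lebesgue)"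
      by (intro qpft_L1_diff_bound \<Lambda> truncate f)
    also have "\<dots> = (\<integral>x. (norm ((truncate m f x - f x) - (truncate n f x - f x)))\<^sup>2 \<partial>lebesgue)"
      by simp
    also have "\<dots> \<le> 2 * (\<integral>x. (norm (truncate m f x - f x))\<^sup>2 \<partial>lebesgue) + 2 * (\<integral>x. (norm (truncate n f x - f x))\<^sup>2 \<partial>lebesgue)"
      by (rule square_integrable_diff(2)[OF sd sd])
    also have "\<dots> < e"
      using N[OF mn(1)] N[OF mn(2)] by simp
    finally show "(\<integral>x. (norm (qpft_L1 \<Lambda> (truncate m f) x - qpft_L1 \<Lambda> (truncate n f) x))\<^sup>2 \<partial>lebesgue) < e" .
  qed
qed

lemma L2_limit_unique:
  assumes u: "\<And>n. square_integrable lebesgue (u n)" and "L2_limit u v" "L2_limit u w"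
  shows "AE x in lebesgue. v x = w x"
proof -
  have v: "square_integrable lebesgue v" and w: "square_integrable lebesgue w"
    and lv: "(\<lambda>n. \<integral>x. (norm (u n x - v x))\<^sup>2 \<partial>lebesgue) \<longlonglongrightarrow> 0"
    and lw: "(\<lambda>n. \<integral>x. (norm (u n x - w x))\<^sup>2 \<partial>lebesgue) \<longlonglongrightarrow> 0"
    using assms by (auto simp: L2_limit_def)
  have "(\<integral>x. (norm (v x - w x))\<^sup>2 \<partial>lebesgue) \<le> 0"
  proof (rule LIMSEQ_le_const)
    show "(\<lambda>n. 2 * (\<integral>x. (norm (u n x - w x))\<^sup>2 \<partial>lebesgue) + 2 * (\<integral>x. (norm (u n x - v x))\<^sup>2 \<partial>lebesgue)) \<longlonglongrightarrow> 0"
      using tendsto_add[OF tendsto_mult_right[OF lw, of 2] tendsto_mult_right[OF lv, of 2]]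
      by (simp add: mult.commute)
    show "\<exists>N. \<forall>n\<ge>N. (\<integral>x. (norm (v x - w x))\<^sup>2 \<partial>lebesgue) \<le>
      2 * (\<integral>x. (norm (u n x - w x))\<^sup>2 \<partial>lebesgue) + 2 * (\<integral>x. (norm (u n x - v x))\<^sup>2 \<partial>lebesgue)"
    proof (intro exI allI impI)
      fix n
      show "(\<integral>x. (norm (v x - w x))\<^sup>2 \<partial>lebesgue) \<le>
        2 * (\<integral>x. (norm (u n x - w x))\<^sup>2 \<partial>lebesgue) + 2 * (\<integral>x. (norm (u n x - v x))\<^sup>2 \<partial>lebesgue)"
        using square_integrable_diff(2)[OF square_integrable_diff(1)[OF u[of n] w] square_integrable_diff(1)[OF u[of n] v]]
        by simp
    qed
  qed
  then have "(\<integral>x. (norm (v x - w x))\<^sup>2 \<partial>lebesgue) = 0"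
    by (intro antisym) simp_all
  then have "AE x in lebesgue. (norm (v x - w x))\<^sup>2 = 0"
    by (subst (asm) integral_nonneg_eq_0_iff_AE) (auto intro: square_integrableD(2)[OF square_integrable_diff(1)[OF v w]])
  then show ?thesis by simp
qed

lemma L2_norm_less_iff: "e > 0 \<Longrightarrow> L2_norm f < e \<longleftrightarrow> (\<integral>x. (norm (f x))\<^sup>2 \<partial>lebesgue) < e\<^sup>2"
  using real_sqrt_less_iff[of _ "e\<^sup>2"] by (simp add: L2_norm_def)

text \<open>
The extension sends \<open>f\<close> to the limit of the transforms of its truncations.  It inherits a Lipschitz
bound from \<open>qpft_L1_diff_bound\<close>, and it agrees with the transform of an integrable \<open>f\<close> because that
transform is a limit of the same sequence.
\<close>
theorem qpft_L2_extension_exists: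
  fixes \<Lambda> :: "qpft_param ^ 'n"
  assumes \<Lambda>: "nondegenerate \<Lambda>"
  shows "\<exists>T. qpft_L2_extension \<Lambda> T"
proof -
  define Q where "Q f n = qpft_L1 \<Lambda> (truncate n f)" for f n
  define T where "T f = (SOME v. L2_limit (Q f) v)" for f
  have T: "L2_limit (Q f) (T f)" if "square_integrable lebesgue f" for f
    unfolding T_def Q_def by (rule someI_ex[OF ex_L2_limit_qpft[OF \<Lambda> that]])
  have Q: "square_integrable lebesgue (Q f n)" if "square_integrable lebesgue f" for f n
    unfolding Q_def by (intro Plancherel_bound \<Lambda> truncate that)
  have T2: "square_integrable lebesgue (T f)" and Tl: "(\<lambda>n. \<integral>x. (norm (Q f n x - T f x))\<^sup>2 \<partial>lebesgue) \<longlonglongrightarrow> 0"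
    if "square_integrable lebesgue f" for f
    using T[OF that] by (auto simp: L2_limit_def)
  have lip: "(\<integral>x. (norm (T g x - T f x))\<^sup>2 \<partial>lebesgue) \<le> 2 * (\<integral>x. (norm (g x - f x))\<^sup>2 \<partial>lebesgue)"
    if g: "square_integrable lebesgue g" and f: "square_integrable lebesgue f" for f g
  proof (rule LIMSEQ_le_const)
    let ?A = "\<lambda>n. \<integral>x. (norm (Q g n x - T g x))\<^sup>2 \<partial>lebesgue"
    let ?B = "\<lambda>n. \<integral>x. (norm (Q f n x - T f x))\<^sup>2 \<partial>lebesgue"
    let ?D = "\<integral>x. (norm (g x - f x))\<^sup>2 \<partial>lebesgue"
    \<comment> \<open>\<open>T g - T f\<close> differs from \<open>Q g n - Q f n\<close> by the two approximation errors, which vanish in the limit.\<close>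
    show "(\<lambda>n. 2 * (2 * ?B n + 2 * ?A n) + 2 * ?D) \<longlonglongrightarrow> 2 * ?D"
      using tendsto_add[OF tendsto_mult[OF tendsto_const[of 4] Tl[OF f]]
          tendsto_add[OF tendsto_mult[OF tendsto_const[of 4] Tl[OF g]] tendsto_const[of "2 * ?D"]]]
      by (simp add: algebra_simps)
    show "\<exists>N. \<forall>n\<ge>N. (\<integral>x. (norm (T g x - T f x))\<^sup>2 \<partial>lebesgue) \<le> 2 * (2 * ?B n + 2 * ?A n) + 2 * ?D"
    proof (intro exI allI impI)
      fix n
      note a = square_integrable_diff[OF square_integrable_diff(1)[OF Q[OF f, of n] T2[OF f]] square_integrable_diff(1)[OF Q[OF g, of n] T2[OF g]]]
      note b = square_integrable_diff(1)[OF Q[OF g, of n] Q[OF f, of n]]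
      have "(\<integral>x. (norm (T g x - T f x))\<^sup>2 \<partial>lebesgue)
        = (\<integral>x. (norm (((Q f n x - T f x) - (Q g n x - T g x)) + (Q g n x - Q f n x)))\<^sup>2 \<partial>lebesgue)"
        by simp
      also have "\<dots> \<le> 2 * (\<integral>x. (norm ((Q f n x - T f x) - (Q g n x - T g x)))\<^sup>2 \<partial>lebesgue)
          + 2 * (\<integral>x. (norm (Q g n x - Q f n x))\<^sup>2 \<partial>lebesgue)"
        by (rule square_integrable_add(2)[OF a(1) b])
      also have "\<dots> \<le> 2 * (2 * ?B n + 2 * ?A n) + 2 * (\<integral>x. (norm (truncate n g x - truncate n f x))\<^sup>2 \<partial>lebesgue)"
        unfolding Q_def by (intro add_mono mult_left_mono a(2)[unfolded Q_def] qpft_L1_diff_bound \<Lambda> truncate f g) auto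
      also have "(\<integral>x. (norm (truncate n g x - truncate n f x))\<^sup>2 \<partial>lebesgue) \<le> ?D"
      proof (rule integral_mono)
        show "integrable lebesgue (\<lambda>x. (norm (truncate n g x - truncate n f x))\<^sup>2)"
          by (intro square_integrableD square_integrable_diff truncate f g)
        show "integrable lebesgue (\<lambda>x. (norm (g x - f x))\<^sup>2)"
          by (intro square_integrableD square_integrable_diff truncate f g)
      qed (auto simp: truncate_def indicator_def)
      finally show "(\<integral>x. (norm (T g x - T f x))\<^sup>2 \<partial>lebesgue) \<le> 2 * (2 * ?B n + 2 * ?A n) + 2 * ?D"
        by simp
    qed
  qed
  have "qpft_L2_extension \<Lambda> T"
    unfolding qpft_L2_extension_def
  proof (intro conjI ballI allI impI)
    show "T f \<in> L2" if "f \<in> L2" for f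
      using T2 that by (simp add: L2_iff)
    \<comment> \<open>The squared Lipschitz constant is 2, and \<open>2 (\<epsilon> / 2)\<^sup>2 < \<epsilon>\<^sup>2\<close>.\<close>
    show "\<exists>\<delta>>0. \<forall>g\<in>L2. L2_norm (\<lambda>x. g x - f x) < \<delta> \<longrightarrow> L2_norm (\<lambda>\<omega>. T g \<omega> - T f \<omega>) < \<epsilon>"
      if f: "f \<in> L2" and \<epsilon>: "\<epsilon> > 0" for f and \<epsilon> :: real
    proof (intro exI[of _ "\<epsilon> / 2"] conjI ballI impI)
      fix g assume g: "g \<in> L2" and "L2_norm (\<lambda>x. g x - f x) < \<epsilon> / 2"
      then have "(\<integral>x. (norm (g x - f x))\<^sup>2 \<partial>lebesgue) < (\<epsilon> / 2)\<^sup>2"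
        using iffD1[OF L2_norm_less_iff[OF half_gt_zero[OF \<epsilon>]]] by blast
      then have "4 * (\<integral>x. (norm (g x - f x))\<^sup>2 \<partial>lebesgue) < \<epsilon>\<^sup>2"
        by (simp add: power_divide)
      moreover have "0 \<le> (\<integral>x. (norm (g x - f x))\<^sup>2 \<partial>lebesgue)"
        by simp
      ultimately have "2 * (\<integral>x. (norm (g x - f x))\<^sup>2 \<partial>lebesgue) < \<epsilon>\<^sup>2"
        by linarith
      then show "L2_norm (\<lambda>\<omega>. T g \<omega> - T f \<omega>) < \<epsilon>"
        using lip[of g f] f g \<epsilon> by (simp add: L2_norm_less_iff L2_iff)
    qed (use \<epsilon> in auto)
    show "AE \<omega> in lebesgue. T f \<omega> = qpft_L1 \<Lambda> f \<omega>" if "f \<in> L1 \<inter> L2" for f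
    proof -
      have f: "integrable lebesgue f" "square_integrable lebesgue f"
        using that by (auto simp: L1_iff L2_iff)
      have "L2_limit (Q f) (qpft_L1 \<Lambda> f)"
        unfolding L2_limit_def
      proof
        show "square_integrable lebesgue (qpft_L1 \<Lambda> f)"
          by (intro Plancherel_bound \<Lambda> f)
        show "(\<lambda>n. \<integral>x. (norm (Q f n x - qpft_L1 \<Lambda> f x))\<^sup>2 \<partial>lebesgue) \<longlonglongrightarrow> 0"
        proof (rule tendsto_sandwich[OF _ _ tendsto_const truncate(3)[OF f(2)]])
          show "\<forall>\<^sub>F n in sequentially. (\<integral>x. (norm (Q f n x - qpft_L1 \<Lambda> f x))\<^sup>2 \<partial>lebesgue)
             \<le> (\<integral>x. (norm (truncate n f x - f x))\<^sup>2 \<partial>lebesgue)"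
            unfolding Q_def by (intro always_eventually allI qpft_L1_diff_bound \<Lambda> truncate f)
        qed auto
      qed
      with T[OF f(2)] show ?thesis
        by (intro L2_limit_unique[of "Q f"] Q f(2))
    qed
  qed
  then show ?thesis by blast
qed

lemma qpft_L2_extension:
  assumes "nondegenerate \<Lambda>"
  shows "qpft_L2_extension \<Lambda> (qpft_L2 \<Lambda>)"
  unfolding qpft_L2_def by (rule someI_ex[OF qpft_L2_extension_exists[OF assms]])

section \<open>Damped inversion for square-integrable functions\<close>

text \<open>
Both sides are integrals against fixed square-integrable functions, so the formula for the integrable
truncations of \<open>f\<close> survives their convergence to \<open>f\<close> in mean square.
\<close>
lemma damped_inversion_L2:
  fixes \<Lambda> :: "qpft_param ^ 'n"
  assumes \<Lambda>: "nondegenerate \<Lambda>" and T: "qpft_L2_extension \<Lambda> T" and s: "s > 0" and f: "square_integrable lebesgue f"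
  shows "(\<integral>\<omega>. T f \<omega> * (of_real (damp \<Lambda> s \<omega>) * cnj (qpft_kernel \<Lambda> \<omega> y)) \<partial>lebesgue)
    = (\<integral>x. f x * (chirp \<Lambda> x * cnj (chirp \<Lambda> y) * of_real (gauss s (x - y))) \<partial>lebesgue)"
proof -
  let ?w = "\<lambda>\<omega>. of_real (damp \<Lambda> s \<omega>) * cnj (qpft_kernel \<Lambda> \<omega> y)"
  let ?g = "\<lambda>x. chirp \<Lambda> x * cnj (chirp \<Lambda> y) * of_real (gauss s (x - y))"
  have w: "square_integrable lebesgue ?w"
  proof (rule square_integrable_bounded)
    show "integrable lebesgue (\<lambda>\<omega>. (kernel_modulus \<Lambda>)\<^sup>2 * damp \<Lambda> s \<omega>)"
      by (intro integrable_mult_right integrable_damp \<Lambda> s)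
    show "(norm (?w \<omega>))\<^sup>2 \<le> (kernel_modulus \<Lambda>)\<^sup>2 * damp \<Lambda> s \<omega>" for \<omega>
    proof -
      have "(damp \<Lambda> s \<omega>)\<^sup>2 \<le> damp \<Lambda> s \<omega>"
        using mult_left_mono[OF damp_le_1[of \<Lambda> s \<omega>] damp_nonneg[of \<Lambda> s \<omega>]] by (simp add: power2_eq_square)
      then show ?thesis
        by (simp add: norm_mult norm_qpft_kernel power_mult_distrib mult_left_mono mult.commute[of _ "(kernel_modulus \<Lambda>)\<^sup>2"])
    qed
  qed measurable
  have g: "square_integrable lebesgue ?g"
    by (rule square_integrable_bounded[OF _ square_integrableD(2)[OF square_integrable_gauss[OF s, of y]]])
       (auto simp: norm_mult)
  have L2f: "f \<in> L2" using f by (simp add: L2_iff)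
  have trL: "truncate n f \<in> L1 \<inter> L2" for n
    using truncate[OF f] by (simp add: L1_iff L2_iff)
  have Tsq: "square_integrable lebesgue (T g)" if "g \<in> L2" for g
    using T that by (auto simp: qpft_L2_extension_def L2_iff[symmetric])
  have lim: "(\<lambda>n. \<integral>\<omega>. (norm (T (truncate n f) \<omega> - T f \<omega>))\<^sup>2 \<partial>lebesgue) \<longlonglongrightarrow> 0"
  proof (rule LIMSEQ_I)
    fix r :: real assume r: "r > 0"
    then have "sqrt r > 0" by simp
    with T L2f obtain \<delta> where \<delta>: "\<delta> > 0"
      "\<And>g. g \<in> L2 \<Longrightarrow> L2_norm (\<lambda>x. g x - f x) < \<delta> \<Longrightarrow> L2_norm (\<lambda>\<omega>. T g \<omega> - T f \<omega>) < sqrt r"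
      unfolding qpft_L2_extension_def by blast
    have "\<forall>\<^sub>F n in sequentially. (\<integral>x. (norm (truncate n f x - f x))\<^sup>2 \<partial>lebesgue) < \<delta>\<^sup>2"
      using order_tendstoD(2)[OF truncate(3)[OF f], of "\<delta>\<^sup>2"] \<delta>(1) by simp
    then obtain N where N: "\<And>n. n \<ge> N \<Longrightarrow> (\<integral>x. (norm (truncate n f x - f x))\<^sup>2 \<partial>lebesgue) < \<delta>\<^sup>2"
      by (auto simp: eventually_sequentially)
    show "\<exists>N. \<forall>n\<ge>N. norm ((\<integral>\<omega>. (norm (T (truncate n f) \<omega> - T f \<omega>))\<^sup>2 \<partial>lebesgue) - 0) < r"
    proof (intro exI[of _ N] allI impI)
      fix n assume "n \<ge> N"
      then have "L2_norm (\<lambda>x. truncate n f x - f x) < \<delta>"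
        using N \<delta>(1) by (simp add: L2_norm_less_iff)
      then have "L2_norm (\<lambda>\<omega>. T (truncate n f) \<omega> - T f \<omega>) < sqrt r"
        using \<delta>(2) trL by blast
      then have "(\<integral>\<omega>. (norm (T (truncate n f) \<omega> - T f \<omega>))\<^sup>2 \<partial>lebesgue) < r"
        using r by (simp add: L2_norm_less_iff)
      then show "norm ((\<integral>\<omega>. (norm (T (truncate n f) \<omega> - T f \<omega>))\<^sup>2 \<partial>lebesgue) - 0) < r"
        by simp
    qed
  qed
  have "(\<lambda>n. \<integral>\<omega>. T (truncate n f) \<omega> * ?w \<omega> \<partial>lebesgue) \<longlonglongrightarrow> (\<integral>\<omega>. T f \<omega> * ?w \<omega> \<partial>lebesgue)"
    using trL by (intro tendsto_integral_mult Tsq L2f w lim) auto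
  moreover have "(\<integral>\<omega>. T (truncate n f) \<omega> * ?w \<omega> \<partial>lebesgue) = (\<integral>x. truncate n f x * ?g x \<partial>lebesgue)" for n
  proof -
    have ae: "AE \<omega> in lebesgue. T (truncate n f) \<omega> = qpft_L1 \<Lambda> (truncate n f) \<omega>"
      using T trL[of n] unfolding qpft_L2_extension_def by blast
    have "truncate n f \<in> L2" using trL by blast
    note [measurable] = square_integrableD(1)[OF Tsq[OF this]] qpft_L1_measurable[OF truncate(1)[OF f, of n]]
    have "(\<integral>\<omega>. T (truncate n f) \<omega> * ?w \<omega> \<partial>lebesgue) = (\<integral>\<omega>. qpft_L1 \<Lambda> (truncate n f) \<omega> * ?w \<omega> \<partial>lebesgue)"
    proof (rule integral_cong_AE)
      show "(\<lambda>\<omega>. T (truncate n f) \<omega> * ?w \<omega>) \<in> borel_measurable lebesgue"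
        by measurable
      show "(\<lambda>\<omega>. qpft_L1 \<Lambda> (truncate n f) \<omega> * ?w \<omega>) \<in> borel_measurable lebesgue"
        by measurable
      show "AE \<omega> in lebesgue. T (truncate n f) \<omega> * ?w \<omega> = qpft_L1 \<Lambda> (truncate n f) \<omega> * ?w \<omega>"
        using ae by eventually_elim simp
    qed
    also have "\<dots> = (\<integral>x. truncate n f x * ?g x \<partial>lebesgue)"
      by (rule damped_inversion_L1[OF \<Lambda> s truncate(1)[OF f]])
    finally show ?thesis .
  qed
  moreover have "(\<lambda>n. \<integral>x. truncate n f x * ?g x \<partial>lebesgue) \<longlonglongrightarrow> (\<integral>x. f x * ?g x \<partial>lebesgue)"
    by (intro tendsto_integral_mult truncate f g)
  ultimately show ?thesis
    using LIMSEQ_unique by simp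
qed

section \<open>Gaussian averages of boxes\<close>

lemma lborel_integral_affine:
  fixes \<phi> :: "'a::euclidean_space \<Rightarrow> real" and t :: 'a
  assumes [measurable]: "\<phi> \<in> borel_measurable borel" and c: "c \<noteq> 0"
  shows "(\<integral>y. \<phi> y \<partial>lborel) = \<bar>c\<bar> ^ DIM('a) * (\<integral>z. \<phi> (t + c *\<^sub>R z) \<partial>lborel)"
proof -
  have "(\<integral>y. \<phi> y \<partial>lborel) = (\<integral>y. \<phi> y \<partial>density (distr lborel borel (\<lambda>x. t + c *\<^sub>R x)) (\<lambda>_. ennreal (\<bar>c\<bar> ^ DIM('a))))"
    using lborel_affine[OF c, of t] by (simp add: ennreal_power)
  also have "\<dots> = (\<integral>y. \<bar>c\<bar> ^ DIM('a) *\<^sub>R \<phi> y \<partial>distr lborel borel (\<lambda>x. t + c *\<^sub>R x))"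
    by (rule integral_density) auto
  also have "\<dots> = \<bar>c\<bar> ^ DIM('a) * (\<integral>z. \<phi> (t + c *\<^sub>R z) \<partial>lborel)"
    by (simp add: integral_distr)
  finally show ?thesis .
qed

text \<open>
The convolution of the indicator function of \<open>B\<close> with the Gaussian density.
\<close>
definition gauss_average :: "(real ^ 'n) set \<Rightarrow> real \<Rightarrow> real ^ 'n \<Rightarrow> real" where
  "gauss_average B s x = (\<integral>y. indicator B y * gauss s (x - y) \<partial>lebesgue)"

lemma gauss_scaleR:
  fixes z :: "real ^ 'n"
  assumes "s > 0"
  shows "s ^ CARD('n) * gauss s (s *\<^sub>R z) = gauss 1 z"
proof -
  have "s * (1 / sqrt (2 * pi * s\<^sup>2)) = 1 / sqrt (2 * pi)"
    using assms by (simp add: real_sqrt_mult)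
  then have "s ^ CARD('n) * (1 / sqrt (2 * pi * s\<^sup>2)) ^ CARD('n) = (1 / sqrt (2 * pi)) ^ CARD('n)"
    by (metis power_mult_distrib)
  moreover have "- (norm (s *\<^sub>R z))\<^sup>2 / (2 * s\<^sup>2) = - (norm z)\<^sup>2 / 2"
    using assms by (simp add: power_mult_distrib)
  moreover have "gauss 1 z = (1 / sqrt (2 * pi)) ^ CARD('n) * exp (- (norm z)\<^sup>2 / 2)"
    using gauss_eq_exp_norm[of 1 z] by simp
  ultimately show ?thesis
    by (simp only: gauss_eq_exp_norm[OF assms] mult.assoc[symmetric])
qed

text \<open>
The substitution \<open>y = x - s z\<close> moves the parameter from the density into the set, which makes both
the limit \<open>s \<rightarrow> 0\<close> and bounds uniform in \<open>s\<close> accessible.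
\<close>
lemma gauss_average_rescaled:
  fixes B :: "(real ^ 'n) set"
  assumes [measurable]: "B \<in> sets borel" and s: "s > 0"
  shows "gauss_average B s x = (\<integral>z. indicator B (x - s *\<^sub>R z) * gauss 1 z \<partial>lborel)"
proof -
  have "gauss_average B s x = (\<integral>y. indicator B y * gauss s (x - y) \<partial>lborel)"
    unfolding gauss_average_def by (rule integral_completion) measurable
  also have "\<dots> = s ^ CARD('n) * (\<integral>z. indicator B (x - s *\<^sub>R z) * gauss s (s *\<^sub>R z) \<partial>lborel)"
    using s by (subst lborel_integral_affine[where c = "- s" and t = x]) auto
  also have "\<dots> = (\<integral>z. indicator B (x - s *\<^sub>R z) * (s ^ CARD('n) * gauss s (s *\<^sub>R z)) \<partial>lborel)"
    by (subst integral_mult_right_zero[symmetric]) (simp add: mult_ac)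
  finally show ?thesis
    unfolding gauss_scaleR[OF s] .
qed

lemma gauss_average_tendsto:
  fixes B :: "(real ^ 'n) set"
  assumes [measurable]: "B \<in> sets borel" and x: "x \<notin> frontier B"
    and \<sigma>: "\<And>n. \<sigma> n > 0" "\<sigma> \<longlonglongrightarrow> 0"
  shows "(\<lambda>n. gauss_average B (\<sigma> n) x) \<longlonglongrightarrow> indicator B x"
proof -
  note g1 = gauss_translate[of 1 "0 :: real ^ 'n", simplified]
  have cont: "isCont (indicator B :: _ \<Rightarrow> real) x"
    using x by (simp add: isCont_indicator)
  have "(\<lambda>n. \<integral>z. indicator B (x - \<sigma> n *\<^sub>R z) * gauss 1 z \<partial>lborel) \<longlonglongrightarrow> (\<integral>z. indicator B x * gauss 1 z \<partial>(lborel :: (real ^ 'n) measure))"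
  proof (rule integral_dominated_convergence)
    show "integrable lborel (gauss 1 :: real ^ 'n \<Rightarrow> real)" by (rule g1)
    show "AE z in lborel. (\<lambda>n. indicator B (x - \<sigma> n *\<^sub>R z) * gauss 1 z) \<longlonglongrightarrow> indicator B x * gauss 1 z"
    proof (intro AE_I2 tendsto_mult tendsto_const)
      fix z :: "real ^ 'n"
      have "(\<lambda>n. x - \<sigma> n *\<^sub>R z) \<longlonglongrightarrow> x - 0 *\<^sub>R z"
        by (intro tendsto_intros \<sigma>)
      then show "(\<lambda>n. indicator B (x - \<sigma> n *\<^sub>R z) :: real) \<longlonglongrightarrow> indicator B x"
        using isCont_tendsto_compose[OF cont] by simp
    qed
    show "AE z in lborel. norm (indicator B (x - \<sigma> n *\<^sub>R z) * gauss 1 z) \<le> gauss 1 z" for n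
      by (auto simp: indicator_def)
  qed measurable
  then show ?thesis
    by (simp add: gauss_average_rescaled \<sigma> g1)
qed

text \<open>
A bound with Gaussian decay, uniform in \<open>s \<le> 1\<close>, which serves as a square-integrable majorant.  If
\<open>x - s z\<close> lies in a ball of radius \<open>R\<close>, then \<open>\<bar>x\<bar>\<^sup>2 \<le> 2 R\<^sup>2 + 2 \<bar>z\<bar>\<^sup>2\<close>; hence half of the exponent
\<open>- \<bar>z\<bar>\<^sup>2 / 2\<close> pays for the decay in \<open>x\<close>, and the other half is a density of variance 2, still
integrable in \<open>z\<close>.
\<close>
lemma gauss_average_le:
  fixes B :: "(real ^ 'n) set"
  assumes [measurable]: "B \<in> sets borel" and B: "bounded B"
  shows "\<exists>D. \<forall>s x. 0 < s \<longrightarrow> s \<le> 1 \<longrightarrow> gauss_average B s x \<le> D * gauss 2 x"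
proof -
  obtain R where R: "\<And>y. y \<in> B \<Longrightarrow> norm y \<le> R"
    using B by (auto simp: bounded_iff)
  define c where "c s = (1 / sqrt (2 * pi * s\<^sup>2)) ^ CARD('n)" for s :: real
  have c: "c s > 0" if "s > 0" for s
    unfolding c_def using that by simp
  have g: "gauss s z = c s * exp (- (norm z)\<^sup>2 / (2 * s\<^sup>2))" if "s > 0" for s and z :: "real ^ 'n"
    unfolding c_def using gauss_eq_exp_norm[OF that] .
  let ?r = "sqrt 2"
  define D where "D = c 1 / (c ?r * c 2) * exp (R\<^sup>2 / 4)"
  have "gauss_average B s x \<le> D * gauss 2 x" if s: "0 < s" "s \<le> 1" for s and x :: "real ^ 'n"
  proof -
    have pt: "indicator B (x - s *\<^sub>R z) * gauss 1 z \<le> (D * gauss 2 x) * gauss ?r z" for z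
    proof (cases "x - s *\<^sub>R z \<in> B")
      case True
      have "norm x \<le> norm (x - s *\<^sub>R z) + norm (s *\<^sub>R z)"
        by (metis diff_add_cancel norm_triangle_ineq)
      also have "\<dots> \<le> R + 1 * norm z"
        unfolding norm_scaleR by (intro add_mono mult_right_mono R True) (use s in auto)
      finally have "(norm x)\<^sup>2 \<le> (R + norm z)\<^sup>2"
        by (intro power_mono) auto
      also have "\<dots> \<le> 2 * R\<^sup>2 + 2 * (norm z)\<^sup>2"
        using sum_squares_bound[of R "norm z"] by (simp add: power2_sum)
      finally have "- (norm z)\<^sup>2 / 2 \<le> R\<^sup>2 / 4 + (- (norm x)\<^sup>2 / 8) + (- (norm z)\<^sup>2 / 4)"
        by simp
      then have "exp (- (norm z)\<^sup>2 / 2) \<le> exp (R\<^sup>2 / 4) * exp (- (norm x)\<^sup>2 / 8) * exp (- (norm z)\<^sup>2 / 4)"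
        by (simp flip: exp_add)
      then have "c 1 * exp (- (norm z)\<^sup>2 / 2) \<le> c 1 * (exp (R\<^sup>2 / 4) * exp (- (norm x)\<^sup>2 / 8) * exp (- (norm z)\<^sup>2 / 4))"
        using c[of 1] by (intro mult_left_mono) auto
      also have "\<dots> = D * (c 2 * exp (- (norm x)\<^sup>2 / 8)) * (c ?r * exp (- (norm z)\<^sup>2 / 4))"
        using c[of 2] c[of ?r] by (simp add: D_def)
      finally show ?thesis
        using True by (simp add: g)
    next
      case False
      have "0 \<le> (D * gauss 2 x) * gauss ?r z"
        using c[of 1] c[of 2] c[of ?r] by (intro mult_nonneg_nonneg) (auto simp: D_def)
      then show ?thesis using False by simp
    qed
    have i1: "integrable lborel (\<lambda>z. indicator B (x - s *\<^sub>R z) * gauss 1 z)"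
      by (rule Bochner_Integration.integrable_bound[of _ "gauss 1"])
         (use gauss_translate(1)[of 1 "0 :: real ^ 'n"] in \<open>auto simp: indicator_def\<close>)
    have i2: "integrable lborel (\<lambda>z. (D * gauss 2 x) * gauss ?r (z :: real ^ 'n))"
      using gauss_translate(1)[of ?r "0 :: real ^ 'n"] by (intro integrable_mult_right) simp
    have "gauss_average B s x = (\<integral>z. indicator B (x - s *\<^sub>R z) * gauss 1 z \<partial>lborel)"
      using s by (intro gauss_average_rescaled) auto
    also have "\<dots> \<le> (\<integral>z. (D * gauss 2 x) * gauss ?r (z :: real ^ 'n) \<partial>lborel)"
      by (rule integral_mono[OF i1 i2 pt])
    also have "\<dots> = D * gauss 2 x"
      using gauss_translate(2)[of ?r "0 :: real ^ 'n"] by (subst integral_mult_right_zero) simp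
    finally show ?thesis .
  qed
  then show ?thesis by blast
qed

lemma gauss_average_nonneg: "gauss_average B s x \<ge> 0"
  unfolding gauss_average_def by (intro Bochner_Integration.integral_nonneg) simp

lemma gauss_average_measurable [measurable]:
  assumes [measurable]: "B \<in> sets lebesgue"
  shows "gauss_average B s \<in> borel_measurable lebesgue"
proof -
  have "(\<lambda>(x, y). indicator B y * gauss s (x - y)) \<in> borel_measurable (lebesgue \<Otimes>\<^sub>M lebesgue)"
    unfolding case_prod_beta' by measurable
  then show ?thesis
    unfolding gauss_average_def[abs_def] by (rule lebesgue.borel_measurable_lebesgue_integral)
qed

text \<open>
The averages converge off the boundary of the box, which is a null set, with the majorant of
\<open>gauss_average_le\<close>; square-integrability of \<open>F\<close> makes its product with the majorant integrable.
\<close>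
lemma integral_mult_gauss_average_tendsto:
  fixes F :: "real ^ 'n \<Rightarrow> complex"
  assumes F: "square_integrable lebesgue F" and \<sigma>: "\<And>n. \<sigma> n > 0" "\<And>n. \<sigma> n \<le> 1" "\<sigma> \<longlonglongrightarrow> 0"
  shows "(\<lambda>n. \<integral>x. F x * of_real (gauss_average (cbox a b) (\<sigma> n) x) \<partial>lebesgue)
      \<longlonglongrightarrow> (\<integral>x. F x * indicator (cbox a b) x \<partial>lebesgue)"
proof -
  note [measurable] = square_integrableD(1)[OF F]
  have [measurable]: "cbox a b \<in> sets lebesgue" by simp
  obtain D where D: "\<And>s x. 0 < s \<Longrightarrow> s \<le> 1 \<Longrightarrow> gauss_average (cbox a b) s x \<le> D * gauss 2 x"
    using gauss_average_le[of "cbox a b"] by auto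
  show ?thesis
  proof (rule integral_dominated_convergence)
    have "integrable lebesgue (\<lambda>x. F x * of_real (gauss 2 (x - 0)))"
      by (intro square_integrable_mult F square_integrable_gauss) simp
    then have "integrable lebesgue (\<lambda>x. norm (F x * of_real (gauss 2 (x - 0))))"
      by (rule integrable_norm)
    then show "integrable lebesgue (\<lambda>x. norm (F x) * (D * gauss 2 x))"
      by (simp add: norm_mult mult.left_commute)
    have "frontier (cbox a b) \<in> null_sets lebesgue"
      using negligible_frontier_interval(1)[of a b] by (simp add: negligible_iff_null_sets frontier_def)
    then have "AE x in lebesgue. x \<notin> frontier (cbox a b)"
      by (rule AE_not_in)
    then show "AE x in lebesgue. (\<lambda>n. F x * of_real (gauss_average (cbox a b) (\<sigma> n) x)) \<longlonglongrightarrow> F x * indicator (cbox a b) x"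
    proof eventually_elim
      case (elim x)
      have "(\<lambda>n. F x * complex_of_real (gauss_average (cbox a b) (\<sigma> n) x)) \<longlonglongrightarrow> F x * of_real (indicator (cbox a b) x)"
        by (intro tendsto_intros gauss_average_tendsto \<sigma> elim) auto
      then show ?case by (cases "x \<in> cbox a b") simp_all
    qed
    show "AE x in lebesgue. norm (F x * of_real (gauss_average (cbox a b) (\<sigma> n) x)) \<le> norm (F x) * (D * gauss 2 x)" for n
      using D[OF \<sigma>(1,2)] by (auto simp: norm_mult gauss_average_nonneg intro!: mult_left_mono)
  qed measurable
qed

section \<open>Bounded pointwise limits of Gaussian smoothings\<close>

lemma integrable_indicator_cbox:
  "integrable lebesgue (indicator (cbox a b) :: 'a::euclidean_space \<Rightarrow> real)"
  by (simp add: emeasure_lborel_cbox_eq)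

text \<open>
Fubini moves the smoothing from \<open>F\<close> to the indicator function of the box.  Absolute integrability
follows from \<open>\<bar>F\<bar> \<le> \<bar>F\<bar>\<^sup>2 + 1\<close>: the first summand is integrable in \<open>x\<close>, and for the second the box
provides integrability in \<open>y\<close>.
\<close>
lemma integral_cbox_smoothed:
  fixes F :: "real ^ 'n \<Rightarrow> complex"
  assumes F: "square_integrable lebesgue F" and s: "s > 0"
  shows "(\<integral>y. indicator (cbox a b) y * (\<integral>x. F x * of_real (gauss s (x - y)) \<partial>lebesgue) \<partial>lebesgue)
    = (\<integral>x. F x * of_real (gauss_average (cbox a b) s x) \<partial>lebesgue)"
proof -
  note [measurable] = square_integrableD(1)[OF F]
  let ?B = "cbox a b"
  define G where "G x y = F x * (indicator ?B y * of_real (gauss s (x - y)))" for x y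
  have G: "integrable (lebesgue \<Otimes>\<^sub>M lebesgue) (\<lambda>p. G (fst p) (snd p))"
  proof (rule Bochner_Integration.integrable_bound)
    show "integrable (lebesgue \<Otimes>\<^sub>M lebesgue) (\<lambda>p. (norm (F (fst p)))\<^sup>2 * gauss s (fst p - snd p)
        + indicator ?B (snd p) * gauss s (fst p - snd p))"
      by (intro Bochner_Integration.integrable_add gauss_tensor square_integrableD(2)[OF F] s integrable_indicator_cbox)
    show "(\<lambda>p. G (fst p) (snd p)) \<in> borel_measurable (lebesgue \<Otimes>\<^sub>M lebesgue)"
      unfolding G_def by measurable
    show "AE p in lebesgue \<Otimes>\<^sub>M lebesgue. norm (G (fst p) (snd p)) \<le> norm ((norm (F (fst p)))\<^sup>2 * gauss s (fst p - snd p)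
        + indicator ?B (snd p) * gauss s (fst p - snd p))"
    proof (intro AE_I2)
      fix p :: "(real ^ 'n) \<times> (real ^ 'n)"
      have "norm (F (fst p)) * gauss s (fst p - snd p) \<le> ((norm (F (fst p)))\<^sup>2 + 1) * gauss s (fst p - snd p)"
        by (intro mult_right_mono norm_le_power2_plus_1) auto
      then show "norm (G (fst p) (snd p)) \<le> norm ((norm (F (fst p)))\<^sup>2 * gauss s (fst p - snd p)
        + indicator ?B (snd p) * gauss s (fst p - snd p))"
        by (auto simp: G_def norm_mult indicator_def algebra_simps)
    qed
  qed
  have "(\<integral>y. indicator ?B y * (\<integral>x. F x * of_real (gauss s (x - y)) \<partial>lebesgue) \<partial>lebesgue)
     = (\<integral>y. (\<integral>x. G x y \<partial>lebesgue) \<partial>lebesgue)"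
    unfolding G_def integral_mult_right_zero[symmetric] by (simp add: mult.left_commute)
  also have "\<dots> = (\<integral>x. (\<integral>y. G x y \<partial>lebesgue) \<partial>lebesgue)"
    using lebesgue_pair.Fubini_integral[of G] G by (simp add: case_prod_beta')
  also have "\<dots> = (\<integral>x. F x * of_real (gauss_average ?B s x) \<partial>lebesgue)"
  proof (intro Bochner_Integration.integral_cong refl)
    fix x
    have "complex_of_real (indicator ?B y) = indicator ?B y" for y
      by (simp add: indicator_def)
    then have "(\<integral>y. G x y \<partial>lebesgue) = F x * (\<integral>y. of_real (indicator ?B y * gauss s (x - y)) \<partial>lebesgue)"
      unfolding G_def integral_mult_right_zero by (simp only: of_real_mult)
    then show "(\<integral>y. G x y \<partial>lebesgue) = F x * of_real (gauss_average ?B s x)"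
      by (simp only: integral_complex_of_real gauss_average_def)
  qed
  finally show ?thesis .
qed

text \<open>
Lebesgue differentiation: almost everywhere the value of \<open>D\<close> is the limit of its means over shrinking
cubes.
\<close>
lemma AE_eq_0_if_cbox_integrals_0:
  fixes D :: "'a::euclidean_space \<Rightarrow> 'b::euclidean_space"
  assumes int: "\<And>a b. set_integrable lebesgue (cbox a b) D"
    and zero: "\<And>a b. set_lebesgue_integral lebesgue (cbox a b) D = 0"
  shows "AE x in lebesgue. D x = 0"
proof -
  have i: "D integrable_on cbox a b" "integral (cbox a b) D = 0" for a b
    using set_lebesgue_integral_eq_integral[OF int[of a b]] zero[of a b] by simp_all
  obtain N where N: "negligible N" and lim: "\<And>x e. \<lbrakk>x \<notin> N; 0 < e\<rbrakk> \<Longrightarrow>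
      \<exists>d>0. \<forall>h. 0 < h \<and> h < d \<longrightarrow> norm (integral (cbox x (x + h *\<^sub>R One)) D /\<^sub>R h ^ DIM('a) - D x) < e"
    using integrable_ccontinuous_explicit[OF i(1)] by blast
  have "D x = 0" if x: "x \<notin> N" for x
  proof (rule ccontr)
    assume "D x \<noteq> 0"
    then obtain d where "d > 0" and d: "\<And>h. 0 < h \<Longrightarrow> h < d \<Longrightarrow> norm (0 /\<^sub>R h ^ DIM('a) - D x) < norm (D x)"
      using lim[OF x, of "norm (D x)"] unfolding i(2) by auto
    from d[of "d / 2"] \<open>d > 0\<close> show False by simp
  qed
  then show ?thesis
    using AE_not_in[of N lebesgue] N by (auto simp: negligible_iff_null_sets elim!: eventually_mono)
qed

text \<open>
Over every box, the integrals of the smoothings converge to that of \<open>H\<close> by bounded convergence and to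
that of \<open>F\<close> by \<open>integral_mult_gauss_average_tendsto\<close>.
\<close>
lemma pointwise_limit_of_gauss_smoothing:
  fixes F H :: "real ^ 'n \<Rightarrow> complex"
  assumes F: "square_integrable lebesgue F" and \<sigma>: "\<And>n. \<sigma> n > 0" "\<And>n. \<sigma> n \<le> 1" "\<sigma> \<longlonglongrightarrow> 0"
    and lim: "\<And>y. (\<lambda>n. \<integral>x. F x * of_real (gauss (\<sigma> n) (x - y)) \<partial>lebesgue) \<longlonglongrightarrow> H y"
    and bound: "\<And>n y. norm (\<integral>x. F x * of_real (gauss (\<sigma> n) (x - y)) \<partial>lebesgue) \<le> C"
  shows "AE x in lebesgue. F x = H x"
proof -
  note [measurable] = square_integrableD(1)[OF F]
  define J where "J n y = (\<integral>x. F x * of_real (gauss (\<sigma> n) (x - y)) \<partial>lebesgue)" for n y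
  have J[measurable]: "J n \<in> borel_measurable lebesgue" for n
  proof -
    have "(\<lambda>(y, x). F x * of_real (gauss (\<sigma> n) (x - y))) \<in> borel_measurable (lebesgue \<Otimes>\<^sub>M lebesgue)"
      unfolding case_prod_beta' by measurable
    then show ?thesis
      unfolding J_def[abs_def] by (rule lebesgue.borel_measurable_lebesgue_integral)
  qed
  have JH: "(\<lambda>n. J n y) \<longlonglongrightarrow> H y" and JC: "norm (J n y) \<le> C" for n y
    unfolding J_def by (rule lim bound)+
  have [measurable]: "H \<in> borel_measurable lebesgue"
    by (rule borel_measurable_LIMSEQ_metric[OF J JH])
  have HC: "norm (H y) \<le> C" for y
    by (rule LIMSEQ_le_const2[OF tendsto_norm[OF JH[of y]]]) (use JC in auto)
  have int_H: "integrable lebesgue (\<lambda>y. indicator (cbox a b) y * H y)" for a b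
  proof (rule Bochner_Integration.integrable_bound)
    show "integrable lebesgue (\<lambda>y. indicator (cbox a b) y * C)"
      by (intro integrable_mult_left integrable_indicator_cbox)
  qed (use HC order_trans[OF HC abs_ge_self] in \<open>auto simp: indicator_def\<close>)
  have int_F: "integrable lebesgue (\<lambda>y. indicator (cbox a b) y * F y)" for a b
  proof (rule Bochner_Integration.integrable_bound)
    show "integrable lebesgue (\<lambda>y. indicator (cbox a b) y + (norm (F y))\<^sup>2)"
      by (intro Bochner_Integration.integrable_add integrable_indicator_cbox square_integrableD(2)[OF F])
    show "AE y in lebesgue. norm (indicator (cbox a b) y * F y) \<le> norm (indicator (cbox a b) y + (norm (F y))\<^sup>2)"
    proof (intro AE_I2)
      fix y
      show "norm (indicator (cbox a b) y * F y) \<le> norm (indicator (cbox a b) y + (norm (F y))\<^sup>2)"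
        using norm_le_power2_plus_1[of "F y"] by (auto simp: indicator_def)
    qed
  qed measurable
  have eq: "(\<integral>y. indicator (cbox a b) y * H y \<partial>lebesgue) = (\<integral>y. indicator (cbox a b) y * F y \<partial>lebesgue)" for a b
  proof (rule LIMSEQ_unique)
    show "(\<lambda>n. \<integral>y. indicator (cbox a b) y * J n y \<partial>lebesgue) \<longlonglongrightarrow> (\<integral>y. indicator (cbox a b) y * H y \<partial>lebesgue)"
    proof (rule integral_dominated_convergence)
      show "integrable lebesgue (\<lambda>y. indicator (cbox a b) y * C)"
        by (intro integrable_mult_left integrable_indicator_cbox)
      show "AE y in lebesgue. (\<lambda>n. indicator (cbox a b) y * J n y) \<longlonglongrightarrow> indicator (cbox a b) y * H y"
        by (intro AE_I2 tendsto_intros JH)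
      show "AE y in lebesgue. norm (indicator (cbox a b) y * J n y) \<le> indicator (cbox a b) y * C" for n
        using JC by (auto simp: indicator_def)
    qed measurable
    have "(\<integral>y. indicator (cbox a b) y * J n y \<partial>lebesgue) = (\<integral>x. F x * of_real (gauss_average (cbox a b) (\<sigma> n) x) \<partial>lebesgue)" for n
      unfolding J_def by (rule integral_cbox_smoothed[OF F \<sigma>(1)])
    then show "(\<lambda>n. \<integral>y. indicator (cbox a b) y * J n y \<partial>lebesgue) \<longlonglongrightarrow> (\<integral>y. indicator (cbox a b) y * F y \<partial>lebesgue)"
      using integral_mult_gauss_average_tendsto[OF F \<sigma>, of a b] by (simp add: mult.commute)
  qed
  have ind: "indicator (cbox a b) y *\<^sub>R (F y - H y) = indicator (cbox a b) y * F y - indicator (cbox a b) y * H y" for a b y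
    by (simp add: indicator_def)
  have "AE x in lebesgue. F x - H x = 0"
  proof (rule AE_eq_0_if_cbox_integrals_0)
    fix a b
    show "set_integrable lebesgue (cbox a b) (\<lambda>x. F x - H x)"
      unfolding set_integrable_def ind by (intro Bochner_Integration.integrable_diff int_F int_H)
    show "set_lebesgue_integral lebesgue (cbox a b) (\<lambda>x. F x - H x) = 0"
      unfolding set_lebesgue_integral_def ind by (simp add: int_F int_H eq)
  qed
  then show ?thesis by simp
qed

section \<open>The inversion formula\<close>

theorem theorem4p6:
  fixes \<Lambda> :: "qpft_param ^ 'n" and f :: "real ^ 'n \<Rightarrow> complex"
  assumes "\<forall>k. case \<Lambda> $ k of (a, b, c, d, e) \<Rightarrow> b \<noteq> 0"
    and "f \<in> L2"
    and "qpft_L2 \<Lambda> f \<in> L1"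
  shows "AE x in lebesgue. f x = (\<integral>t. qpft_L2 \<Lambda> f t * qpft_kernel_neg \<Lambda> t x \<partial>lebesgue)"
proof -
  have \<Lambda>: "nondegenerate \<Lambda>"
    using assms(1) by (simp add: nondegenerate_def)
  have f: "square_integrable lebesgue f"
    using assms(2) by (simp add: L2_iff)
  define g where "g = qpft_L2 \<Lambda> f"
  have g: "integrable lebesgue g"
    using assms(3) by (simp add: L1_iff g_def)
  note [measurable] = square_integrableD(1)[OF f] borel_measurable_integrable[OF g]
  define \<sigma> where "\<sigma> n = inverse (real (Suc n))" for n
  have \<sigma>: "\<sigma> n > 0" "\<sigma> n \<le> 1" "\<sigma> \<longlonglongrightarrow> 0" for n
    using LIMSEQ_inverse_real_of_nat by (simp_all add: \<sigma>_def[abs_def] field_simps)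
  define F where "F x = f x * chirp \<Lambda> x" for x
  define I where "I x = (\<integral>t. g t * cnj (qpft_kernel \<Lambda> t x) \<partial>lebesgue)" for x
  define A where "A n x = (\<integral>t. g t * (of_real (damp \<Lambda> (\<sigma> n) t) * cnj (qpft_kernel \<Lambda> t x)) \<partial>lebesgue)" for n x
  have F: "square_integrable lebesgue F"
    by (rule square_integrable_bounded[OF _ square_integrableD(2)[OF f]]) (auto simp: F_def[abs_def] norm_mult)
  have smooth: "(\<integral>x. F x * of_real (gauss (\<sigma> n) (x - y)) \<partial>lebesgue) = chirp \<Lambda> y * A n y" for n y
  proof -
    have "A n y = (\<integral>x. f x * (chirp \<Lambda> x * cnj (chirp \<Lambda> y) * of_real (gauss (\<sigma> n) (x - y))) \<partial>lebesgue)"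
      unfolding A_def g_def by (rule damped_inversion_L2[OF \<Lambda> qpft_L2_extension[OF \<Lambda>] \<sigma>(1) f])
    also have "\<dots> = (\<integral>x. cnj (chirp \<Lambda> y) * (F x * of_real (gauss (\<sigma> n) (x - y))) \<partial>lebesgue)"
      by (simp add: F_def mult_ac)
    also have "\<dots> = cnj (chirp \<Lambda> y) * (\<integral>x. F x * of_real (gauss (\<sigma> n) (x - y)) \<partial>lebesgue)"
      by (rule integral_mult_right_zero)
    finally show ?thesis
      by (simp add: mult.assoc[symmetric])
  qed
  have gC: "integrable lebesgue (\<lambda>t. kernel_modulus \<Lambda> * norm (g t))"
    using g by auto
  have le: "norm (g t * (of_real (damp \<Lambda> s t) * cnj (qpft_kernel \<Lambda> t x))) \<le> kernel_modulus \<Lambda> * norm (g t)" for s t x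
  proof -
    have "norm (g t * (of_real (damp \<Lambda> s t) * cnj (qpft_kernel \<Lambda> t x))) = damp \<Lambda> s t * (kernel_modulus \<Lambda> * norm (g t))"
      by (simp add: norm_mult norm_qpft_kernel)
    also have "\<dots> \<le> 1 * (kernel_modulus \<Lambda> * norm (g t))"
      by (intro mult_right_mono) auto
    finally show ?thesis by simp
  qed
  have "AE x in lebesgue. F x = chirp \<Lambda> x * I x"
  proof (rule pointwise_limit_of_gauss_smoothing[OF F \<sigma>])
    fix y
    have "(\<lambda>n. A n y) \<longlonglongrightarrow> I y"
      unfolding A_def I_def
    proof (rule integral_dominated_convergence[OF _ _ gC])
      show "AE t in lebesgue. (\<lambda>n. g t * (of_real (damp \<Lambda> (\<sigma> n) t) * cnj (qpft_kernel \<Lambda> t y))) \<longlonglongrightarrow> g t * cnj (qpft_kernel \<Lambda> t y)"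
      proof (intro AE_I2)
        fix t
        have "(\<lambda>n. g t * (of_real (damp \<Lambda> (\<sigma> n) t) * cnj (qpft_kernel \<Lambda> t y))) \<longlonglongrightarrow> g t * (of_real 1 * cnj (qpft_kernel \<Lambda> t y))"
          by (intro tendsto_intros damp_tendsto_1 \<sigma>)
        then show "(\<lambda>n. g t * (of_real (damp \<Lambda> (\<sigma> n) t) * cnj (qpft_kernel \<Lambda> t y))) \<longlonglongrightarrow> g t * cnj (qpft_kernel \<Lambda> t y)"
          by simp
      qed
    qed (use le in \<open>measurable; simp\<close>)+
    then show "(\<lambda>n. \<integral>x. F x * of_real (gauss (\<sigma> n) (x - y)) \<partial>lebesgue) \<longlonglongrightarrow> chirp \<Lambda> y * I y"
      unfolding smooth by (intro tendsto_intros)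
    fix n
    have "norm (A n y) \<le> (\<integral>t. norm (g t * (of_real (damp \<Lambda> (\<sigma> n) t) * cnj (qpft_kernel \<Lambda> t y))) \<partial>lebesgue)"
      unfolding A_def by (rule integral_norm_bound)
    also have "\<dots> \<le> (\<integral>t. kernel_modulus \<Lambda> * norm (g t) \<partial>lebesgue)"
      by (rule integral_mono') (use gC le in auto)
    finally show "norm (\<integral>x. F x * of_real (gauss (\<sigma> n) (x - y)) \<partial>lebesgue) \<le> (\<integral>t. kernel_modulus \<Lambda> * norm (g t) \<partial>lebesgue)"
      by (simp add: smooth norm_mult)
  qed
  then have "AE x in lebesgue. f x = I x"
  proof eventually_elim
    case (elim x)
    have "chirp \<Lambda> x \<noteq> 0"
      using norm_chirp[of \<Lambda> x] by force
    with elim show ?case by (simp add: F_def mult.commute)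
  qed
  then show ?thesis
    by (simp add: I_def g_def qpft_kernel_neg_eq_cnj)
qed

end
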